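(* Let $H=(V,E)$ be an almost disjoint 3-partite 3-hypergraph, let $P$ be a perfect matching of $H$ and let $w:E\to\mathbb{R}$ be a weight function with $w(p)=0$ for each $p\in P$. Then one can construct in polynomial time an almost disjoint 4-partite 4-hypergraph $H'=(V',E')$, a perfect matching $P'$ of $H'$ and a weight function $w':E'\to\mathbb{R}$ with $w'(p)=0$ for each $p\in P'$ such that $$\mathrm{per}(T(H,w,z))=\det(T'),$$ where $T'$ is a signing of $T(H',w',z)$.
   Context: A $k$-hypergraph $H=(V,E)$ has $E$ a set of $k$-element subsets of $V$. It is almost disjoint if any two hyperedges share at most one vertex; it is $k$-partite with parts $V_1,\ldots,V_k$ if $V$ is partitioned into $V_1,\ldots,V_k$ and each hyperedge meets each $V_i$ in exactly one vertex. A perfect matching is a set of pairwise disjoint hyperedges whose union is $V$. For a $k$-partite $k$-hypergraph with weight $w$ and formal variable $z$, the transition matrix $T(H,w,z)$ is the $k$-matrix indexed by $V_1\times\cdots\times V_k$ whose entry at $u=(u_1,\ldots,u_k)$ is $z^{w(e)}$ if $\{u_1,\ldots,u_k\}=e\in E$ and $0$ otherwise. Each part is linearly ordered (parts have equal size), so bijections $\alpha:V_k\to V_j$ have signs. For a $k$-matrix $M$ indexed by $V_1\times\cdots\times V_k$: $\det(M)=\sum_{\alpha_1,\ldots,\alpha_{k-1}}\prod_j\mathrm{sign}(\alpha_j)\prod_{i\in V_k}M_{(\alpha_1(i),\ldots,\alpha_{k-1}(i),i)}$ and $\mathrm{per}(M)$ is the same sum without the signs, over bijections $\alpha_j:V_k\to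 V_j$. A signing of $M$ is obtained by multiplying some entries by $-1$. *)

theory Defs
  imports
    Complex_Main
    "HOL-Library.FuncSet"
    "HOL-Library.Disjoint_Sets"
    "HOL-Library.Poly_Mapping"
    "HOL-Combinatorics.Permutations"
    "HOL-Computational_Algebra.Polynomial"
begin

section \<open>Hypergraphs\<close>

definition k_hypergraph :: "nat \<Rightarrow> 'a set \<Rightarrow> 'a set set \<Rightarrow> bool" where
  "k_hypergraph k V E \<longleftrightarrow> finite V \<and> (\<forall>e\<in>E. e \<subseteq> V \<and> card e = k)"

definition almost_disjoint :: "'a set set \<Rightarrow> bool" where
  "almost_disjoint E \<longleftrightarrow> (\<forall>e\<in>E. \<forall>f\<in>E. e \<noteq> f \<longrightarrow> card (e \<inter> f) \<le> 1)"

definition k_partite :: "nat \<Rightarrow> (nat \<Rightarrow> 'a set) \<Rightarrow> 'a set \<Rightarrow> 'a set set \<Rightarrow> bool" where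
  "k_partite k U V E \<longleftrightarrow>
     (\<Union>i\<in>{1..k}. U i) = V \<and> disjoint_family_on U {1..k} \<and>
     (\<forall>e\<in>E. \<forall>i\<in>{1..k}. card (e \<inter> U i) = 1)"

definition perfect_matching :: "'a set \<Rightarrow> 'a set set \<Rightarrow> 'a set set \<Rightarrow> bool" where
  "perfect_matching V E P \<longleftrightarrow> P \<subseteq> E \<and> disjoint P \<and> \<Union>P = V"


section \<open>Hypermatrices, determinant and permanent\<close>

text \<open>
  A \<open>k\<close>-matrix indexed by \<open>U 1 \<times> \<dots> \<times> U k\<close> is a function on tuples, a tuple being an
  element of \<open>PiE {1..k} U\<close>; values of the function elsewhere are irrelevant.
\<close>

type_synonym ('a, 'r) hypermatrix = "(nat \<Rightarrow> 'a) \<Rightarrow> 'r"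

definition rank_in :: "'a::linorder set \<Rightarrow> 'a \<Rightarrow> nat" where
  "rank_in A x = card {y \<in> A. y < x}"

text \<open>
  The sign of a bijection between finite linearly ordered sets \<open>A\<close> and \<open>B\<close>: both are
  identified with \<open>{..<card A}\<close> by their order isomorphisms, and the library sign of the
  resulting permutation is taken.
\<close>

definition bij_sign :: "'a::linorder set \<Rightarrow> 'a set \<Rightarrow> ('a \<Rightarrow> 'a) \<Rightarrow> int" where
  "bij_sign A B f =
     sign (\<lambda>i. if i < card A then rank_in B (f (sorted_list_of_set A ! i)) else i)"

definition bij_families :: "nat \<Rightarrow> (nat \<Rightarrow> 'a set) \<Rightarrow> (nat \<Rightarrow> 'a \<Rightarrow> 'a) set" where
  "bij_families k U =
     (\<Pi>\<^sub>E j\<in>{1..<k}. {f \<in> U k \<rightarrow>\<^sub>E U j. bij_betw f (U k) (U j)})"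

definition tuple_at :: "nat \<Rightarrow> (nat \<Rightarrow> 'a \<Rightarrow> 'a) \<Rightarrow> 'a \<Rightarrow> nat \<Rightarrow> 'a" where
  "tuple_at k \<alpha> i = (\<lambda>j\<in>{1..k}. if j < k then \<alpha> j i else i)"

definition hyper_per ::
  "nat \<Rightarrow> (nat \<Rightarrow> 'a set) \<Rightarrow> ('a, 'r::comm_ring_1) hypermatrix \<Rightarrow> 'r" where
  "hyper_per k U M = (\<Sum>\<alpha>\<in>bij_families k U. \<Prod>i\<in>U k. M (tuple_at k \<alpha> i))"

definition hyper_det ::
  "nat \<Rightarrow> (nat \<Rightarrow> 'a::linorder set) \<Rightarrow> ('a, 'r::comm_ring_1) hypermatrix \<Rightarrow> 'r" where
  "hyper_det k U M =
     (\<Sum>\<alpha>\<in>bij_families k U.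
        (\<Prod>j\<in>{1..<k}. of_int (bij_sign (U k) (U j) (\<alpha> j))) *
        (\<Prod>i\<in>U k. M (tuple_at k \<alpha> i)))"

definition is_signing ::
  "nat \<Rightarrow> (nat \<Rightarrow> 'a set) \<Rightarrow> ('a, 'r::comm_ring_1) hypermatrix \<Rightarrow>
   ('a, 'r) hypermatrix \<Rightarrow> bool" where
  "is_signing k U M M' \<longleftrightarrow> (\<forall>u\<in>PiE {1..k} U. M' u = M u \<or> M' u = - M u)"

text \<open>
  Formal sums of powers \<open>z^r\<close> with real exponents and integer coefficients are the finitely
  supported functions \<open>real \<Rightarrow>\<^sub>0 int\<close> with convolution as multiplication;
  \<open>Poly_Mapping.single r 1\<close> is \<open>z^r\<close>.
\<close>

definition transition_matrix ::
  "nat \<Rightarrow> 'a set set \<Rightarrow> ('a set \<Rightarrow> real) \<Rightarrow> ('a, real \<Rightarrow>\<^sub>0 int) hypermatrix" where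
  "transition_matrix k E w u =
     (if u ` {1..k} \<in> E then Poly_Mapping.single (w (u ` {1..k})) 1 else 0)"


section \<open>Random access machines\<close>

text \<open>
  Polynomial time is measured on a random access machine with unit costs. Its memory consists
  of registers and arrays of natural numbers and, because edge weights are real numbers, arrays
  of reals. Only addition, (truncated) subtraction and comparison are available, on naturals and
  on reals alike, and the only real constants are 0 and 1. Without multiplication, \<open>t\<close> steps
  increase bit lengths by at most \<open>O(t)\<close>, so that, on rational weights written in binary, unit
  cost and bit cost (hence Turing machine time) are polynomially related. Programs are finite,
  so each one uses boundedly many registers, arrays and expressions of bounded size.
\<close>

datatype name = In nat | Out nat | Tmp nat

record state =
  reg :: "name \<Rightarrow> nat"
  narr :: "name \<Rightarrow> nat \<Rightarrow> nat"
  rarr :: "name \<Rightarrow> nat \<Rightarrow> real"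

datatype nexp = Lit nat | Reg name | Read name nexp | Add nexp nexp | Sub nexp nexp

datatype rexp = RZero | ROne | RRead name nexp | RAdd rexp rexp | RSub rexp rexp

datatype bexp = Less nexp nexp | RLess rexp rexp | Not bexp | And bexp bexp

datatype com =
    Skip
  | Assign name nexp
  | Store name nexp nexp
  | RStore name nexp rexp
  | Seq com com
  | If bexp com com
  | While bexp com

primrec nval :: "nexp \<Rightarrow> state \<Rightarrow> nat" where
  "nval (Lit n) s = n"
| "nval (Reg x) s = reg s x"
| "nval (Read a i) s = narr s a (nval i s)"
| "nval (Add i j) s = nval i s + nval j s"
| "nval (Sub i j) s = nval i s - nval j s"

primrec rval :: "rexp \<Rightarrow> state \<Rightarrow> real" where
  "rval RZero s = 0"
| "rval ROne s = 1"
| "rval (RRead a i) s = rarr s a (nval i s)"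
| "rval (RAdd x y) s = rval x s + rval y s"
| "rval (RSub x y) s = rval x s - rval y s"

primrec bval :: "bexp \<Rightarrow> state \<Rightarrow> bool" where
  "bval (Less i j) s \<longleftrightarrow> nval i s < nval j s"
| "bval (RLess x y) s \<longleftrightarrow> rval x s < rval y s"
| "bval (Not b) s \<longleftrightarrow> \<not> bval b s"
| "bval (And b c) s \<longleftrightarrow> bval b s \<and> bval c s"

text \<open>\<open>exec c s t s'\<close>: started in \<open>s\<close>, program \<open>c\<close> halts in \<open>s'\<close> after \<open>t\<close> steps.\<close>

inductive exec :: "com \<Rightarrow> state \<Rightarrow> nat \<Rightarrow> state \<Rightarrow> bool" where
  Skip: "exec Skip s 1 s"
| Assign: "exec (Assign x i) s 1 (s\<lparr>reg := (reg s)(x := nval i s)\<rparr>)"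
| Store: "exec (Store a i j) s 1
    (s\<lparr>narr := (narr s)(a := (narr s a)(nval i s := nval j s))\<rparr>)"
| RStore: "exec (RStore a i x) s 1
    (s\<lparr>rarr := (rarr s)(a := (rarr s a)(nval i s := rval x s))\<rparr>)"
| Seq: "exec c s t s' \<Longrightarrow> exec d s' t' s'' \<Longrightarrow> exec (Seq c d) s (t + t') s''"
| IfTrue: "bval b s \<Longrightarrow> exec c s t s' \<Longrightarrow> exec (If b c d) s (t + 1) s'"
| IfFalse: "\<not> bval b s \<Longrightarrow> exec d s t s' \<Longrightarrow> exec (If b c d) s (t + 1) s'"
| WhileFalse: "\<not> bval b s \<Longrightarrow> exec (While b c) s 1 s"
| WhileTrue: "bval b s \<Longrightarrow> exec c s t s' \<Longrightarrow> exec (While b c) s' t' s'' \<Longrightarrow>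
    exec (While b c) s (t + t' + 1) s''"

text \<open>
  \<open>encodes nm k \<nu> U E P w s\<close>: the memory cells named by \<open>nm\<close> (one of \<open>In\<close>, \<open>Out\<close>, \<open>Tmp\<close>) hold
  the \<open>k\<close>-partite hypergraph with parts \<open>U 1, \<dots>, U k\<close> and edge set \<open>E\<close>, the set of edges \<open>P\<close>
  and the weight \<open>w\<close>, each vertex \<open>v\<close> being written as the number \<open>\<nu> v\<close>. For \<open>i\<close> from 1 to \<open>k\<close>,
  register \<open>i\<close> holds the size of \<open>U i\<close> and array \<open>i\<close> lists \<open>U i\<close>. Register 0 holds the number
  of edges; for the \<open>j\<close>-th edge, entry \<open>j\<close> of array \<open>k + i\<close> is its vertex in \<open>U i\<close>, entry \<open>j\<close>
  of array 0 tells whether it belongs to \<open>P\<close>, and entry \<open>j\<close> of the real array 0 is its weight.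
  Lists are without repetition, in any order; all other memory contents are arbitrary.
\<close>

definition encodes ::
  "(nat \<Rightarrow> name) \<Rightarrow> nat \<Rightarrow> ('a \<Rightarrow> nat) \<Rightarrow> (nat \<Rightarrow> 'a set) \<Rightarrow> 'a set set \<Rightarrow> 'a set set \<Rightarrow>
   ('a set \<Rightarrow> real) \<Rightarrow> state \<Rightarrow> bool" where
  "encodes nm k \<nu> U E P w s \<longleftrightarrow>
     (\<forall>i\<in>{1..k}. reg s (nm i) = card (U i) \<and>
        bij_betw (narr s (nm i)) {..<card (U i)} (\<nu> ` U i)) \<and>
     reg s (nm 0) = card E \<and>
     (\<exists>es. bij_betw es {..<card E} E \<and>
        (\<forall>j<card E.
           (\<forall>i\<in>{1..k}. narr s (nm (k + i)) j \<in> \<nu> ` (es j \<inter> U i)) \<and>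
           narr s (nm 0) j = (if es j \<in> P then 1 else 0) \<and>
           rarr s (nm 0) j = w (es j)))"

end

(* Let n be the size of the parts of H and write each hyperedge of H as (a, b, c). The new
   hypergraph has, in each part i, a copy c_i of every vertex of V_3, a copy of every vertex of
   V_1 (i odd) or V_2 (i even), and two private vertices p_i, q_i per hyperedge of H. The hyperedge
   (a, b, c) becomes the six hyperedges
     {p_1, p_2, p_3, p_4},  {q_1, q_2, q_3, q_4}                    (rows 0 and 1)
     {a_1, c_2, p_3, q_4},  {p_1, q_2, a_3, c_4}                    (rows 2 and 3)
     {c_1, b_2, q_3, p_4},  {q_1, p_2, c_3, b_4}                    (rows 4 and 5)
   Every private vertex lies in exactly two of them, which forces a perfect matching to contain
   either rows 0 and 1 or rows 2 to 5; the latter cover one full set of copies of a, b, c. Hence perfect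
   matchings of H and of the new hypergraph correspond. Two of the hyperedges of a gadget or of two
   gadgets share at most one vertex because H is almost disjoint.

   Exchanging parts 1 and 3 and parts 2 and 4 preserves the orders of the parts and fixes each
   perfect matching as a set. Hence the bijections that a perfect matching induces from part 1 to
   part 2 and from part 3 to part 4 have the same sign, the product of the signs in the determinant
   is always 1, and no entry has to be negated. *)

theory Submission
  imports Defs
begin

section \<open>Perfect matchings and hypermatrix sums\<close>

text \<open>Hyperedges are given by indices and coordinates: \<open>x i e\<close> is the vertex of
  \<open>e\<close> in part \<open>i\<close>. This keeps sums, products and bijections in coordinate
  form; \<open>coord_inj\<close> makes distinct indices distinct vertex sets.\<close>

locale indexed_hypergraph =
  fixes k :: nat and U :: "nat \<Rightarrow> 'a set" and I :: "'e set" and x :: "nat \<Rightarrow> 'e \<Rightarrow> 'a"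
  assumes k_pos: "1 \<le> k"
    and finite_part: "i \<in> {1..k} \<Longrightarrow> finite (U i)"
    and finite_index: "finite I"
    and disjoint_parts: "disjoint_family_on U {1..k}"
    and coord_in: "i \<in> {1..k} \<Longrightarrow> e \<in> I \<Longrightarrow> x i e \<in> U i"
    and coord_inj: "e \<in> I \<Longrightarrow> f \<in> I \<Longrightarrow> (\<And>i. i \<in> {1..k} \<Longrightarrow> x i e = x i f) \<Longrightarrow> e = f"
begin

definition edge :: "'e \<Rightarrow> 'a set" where
  "edge e = (\<lambda>i. x i e) ` {1..k}"

text \<open>Perfect matchings in coordinate form; see
  \<open>perfect_matching_edge_iff\<close>.\<close>

definition matching :: "'e set \<Rightarrow> bool" where
  "matching J \<longleftrightarrow> J \<subseteq> I \<and> (\<forall>i\<in>{1..k}. bij_betw (x i) J (U i))"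

text \<open>The bijections that \<open>J\<close> contributes to a hypermatrix sum: a vertex of the
  last part goes to the vertex in part \<open>j\<close> of the hyperedge of \<open>J\<close> through
  it.\<close>

definition family :: "'e set \<Rightarrow> nat \<Rightarrow> 'a \<Rightarrow> 'a" where
  "family J = (\<lambda>j\<in>{1..<k}. \<lambda>v\<in>U k. x j (inv_into J (x k) v))"

lemma part_unique: "v \<in> U i \<Longrightarrow> v \<in> U j \<Longrightarrow> i \<in> {1..k} \<Longrightarrow> j \<in> {1..k} \<Longrightarrow> i = j"
  using disjoint_parts unfolding disjoint_family_on_def by blast

lemma edge_Int_part: "e \<in> I \<Longrightarrow> i \<in> {1..k} \<Longrightarrow> edge e \<inter> U i = {x i e}"
  unfolding edge_def using coord_in part_unique by blast

lemma edge_eq_iff: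
  assumes "e \<in> I" "u \<in> PiE {1..k} U"
  shows "u ` {1..k} = edge e \<longleftrightarrow> (\<forall>i\<in>{1..k}. u i = x i e)"
proof
  assume eq: "u ` {1..k} = edge e"
  show "\<forall>i\<in>{1..k}. u i = x i e"
  proof
    fix i assume i: "i \<in> {1..k}"
    then have "u i \<in> edge e \<inter> U i" using eq assms(2) by auto
    then show "u i = x i e" using edge_Int_part[OF assms(1) i] by simp
  qed
qed (auto simp: edge_def intro!: image_cong)

lemma inj_on_edge: "inj_on edge I"
proof (rule inj_onI)
  fix e f assume *: "e \<in> I" "f \<in> I" "edge e = edge f"
  then have "x i e = x i f" if "i \<in> {1..k}" for i
    using edge_Int_part[OF *(1) that] edge_Int_part[OF *(2) that] by simp
  with * show "e = f" by (intro coord_inj)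
qed

lemma k_hypergraph_edge: "k_hypergraph k (\<Union>i\<in>{1..k}. U i) (edge ` I)"
proof -
  have "card (edge e) = k" if "e \<in> I" for e
  proof -
    have "inj_on (\<lambda>i. x i e) {1..k}"
    proof (rule inj_onI)
      fix i j assume *: "i \<in> {1..k}" "j \<in> {1..k}" "x i e = x j e"
      then show "i = j" using part_unique[of "x i e" i j] coord_in[OF _ that] by metis
    qed
    then show ?thesis unfolding edge_def by (simp add: card_image)
  qed
  moreover have "edge e \<subseteq> (\<Union>i\<in>{1..k}. U i)" if "e \<in> I" for e
    using coord_in that unfolding edge_def by blast
  ultimately show ?thesis
    unfolding k_hypergraph_def using finite_part by blast
qed

lemma k_partite_edge: "k_partite k U (\<Union>i\<in>{1..k}. U i) (edge ` I)"
  unfolding k_partite_def using disjoint_parts edge_Int_part by simp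

text \<open>A hyperedge meets part \<open>i\<close> only in its coordinate there, so disjointness of
  the hyperedges is injectivity of every coordinate and covering is surjectivity.\<close>

lemma perfect_matching_edge_iff:
  assumes J: "J \<subseteq> I"
  shows "perfect_matching (\<Union>i\<in>{1..k}. U i) (edge ` I) (edge ` J) \<longleftrightarrow> matching J"
proof
  assume pm: "perfect_matching (\<Union>i\<in>{1..k}. U i) (edge ` I) (edge ` J)"
  have "bij_betw (x i) J (U i)" if i: "i \<in> {1..k}" for i
  proof (rule bij_betw_imageI)
    show "inj_on (x i) J"
    proof (rule inj_onI)
      fix e f assume ef: "e \<in> J" "f \<in> J" "x i e = x i f"
      then have "edge e \<inter> edge f \<noteq> {}" using i unfolding edge_def by blast
      then have "edge e = edge f"
        using pm ef unfolding perfect_matching_def disjoint_def by blast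
      then show "e = f" using ef J inj_on_edge by (meson inj_onD subsetD)
    qed
    show "x i ` J = U i"
    proof
      show "x i ` J \<subseteq> U i" using coord_in i J by blast
      show "U i \<subseteq> x i ` J"
      proof
        fix v assume v: "v \<in> U i"
        then have "v \<in> \<Union>(edge ` J)" using pm i unfolding perfect_matching_def by blast
        then obtain e where "e \<in> J" "v \<in> edge e" by blast
        then show "v \<in> x i ` J" using v edge_Int_part[of e i] i J by blast
      qed
    qed
  qed
  then show "matching J" using J unfolding matching_def by blast
next
  assume m: "matching J"
  then have bij: "\<And>i. i \<in> {1..k} \<Longrightarrow> bij_betw (x i) J (U i)" unfolding matching_def by blast
  have "disjoint (edge ` J)"
  proof (rule disjointI)
    fix A B assume "A \<in> edge ` J" "B \<in> edge ` J" and ne: "A \<noteq> B"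
    then obtain e f where ef: "e \<in> J" "f \<in> J" "A = edge e" "B = edge f" by blast
    show "A \<inter> B = {}"
    proof (rule ccontr)
      assume "A \<inter> B \<noteq> {}"
      then obtain i j where ij: "i \<in> {1..k}" "j \<in> {1..k}" "x i e = x j f"
        unfolding ef edge_def by blast
      then have "i = j" using coord_in ef J part_unique by (metis subsetD)
      then have "e = f" using bij[OF ij(1)] ij ef unfolding bij_betw_def inj_on_def by blast
      then show False using ne ef by simp
    qed
  qed
  moreover have "\<Union>(edge ` J) = (\<Union>i\<in>{1..k}. U i)"
    using bij unfolding edge_def bij_betw_def by blast
  ultimately show "perfect_matching (\<Union>i\<in>{1..k}. U i) (edge ` I) (edge ` J)"
    using J unfolding perfect_matching_def by blast
qed

section \<open>Hypermatrix sums as sums over perfect matchings\<close>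

lemma finite_bij_families: "finite (bij_families k U)"
  unfolding bij_families_def
proof (intro finite_PiE ballI)
  fix j assume "j \<in> {1..<k}"
  then show "finite {f \<in> U k \<rightarrow>\<^sub>E U j. bij_betw f (U k) (U j)}"
    using finite_part k_pos by (intro finite_subset[OF _ finite_PiE[of "U k" "\<lambda>_. U j"]]) auto
qed simp

lemma tuple_at_in: "\<alpha> \<in> bij_families k U \<Longrightarrow> v \<in> U k \<Longrightarrow> tuple_at k \<alpha> v \<in> PiE {1..k} U"
  unfolding bij_families_def tuple_at_def by (auto simp: PiE_iff)

lemma family_apply:
  assumes "matching J" "e \<in> J" "j \<in> {1..<k}"
  shows "family J j (x k e) = x j e"
proof -
  have "bij_betw (x k) J (U k)" using assms(1) k_pos unfolding matching_def by auto
  then have "x k e \<in> U k" "inv_into J (x k) (x k e) = e"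
    using assms(2) by (auto simp: bij_betw_def inv_into_f_f)
  then show ?thesis using assms(3) unfolding family_def by simp
qed

lemma family_in:
  assumes "matching J"
  shows "family J \<in> bij_families k U"
proof -
  have "family J j \<in> U k \<rightarrow>\<^sub>E U j \<and> bij_betw (family J j) (U k) (U j)" if j: "j \<in> {1..<k}" for j
  proof -
    have b: "bij_betw (x k) J (U k)" "bij_betw (x j) J (U j)"
      using assms k_pos j unfolding matching_def by auto
    have "bij_betw (x j \<circ> inv_into J (x k)) (U k) (U j)"
      using bij_betw_trans[OF bij_betw_inv_into[OF b(1)] b(2)] .
    then have c: "bij_betw (family J j) (U k) (U j)"
      using j by (subst bij_betw_cong[where g = "x j \<circ> inv_into J (x k)"]) (auto simp: family_def)
    moreover have "family J j \<in> extensional (U k)" using j by (simp add: family_def)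
    ultimately show ?thesis by (auto simp: PiE_def bij_betw_def)
  qed
  then show ?thesis
    unfolding bij_families_def by (auto simp: PiE_iff family_def)
qed

text \<open>Only the families that select an edge at every index of the last part contribute, and these
  correspond to the perfect matchings.\<close>

lemma sum_bij_families:
  fixes F :: "(nat \<Rightarrow> 'a \<Rightarrow> 'a) \<Rightarrow> real \<Rightarrow>\<^sub>0 int"
  shows "(\<Sum>\<alpha>\<in>bij_families k U. F \<alpha> * (\<Prod>v\<in>U k. transition_matrix k (edge ` I) w (tuple_at k \<alpha> v))) =
    (\<Sum>J | matching J. F (family J) * (\<Prod>e\<in>J. Poly_Mapping.single (w (edge e)) 1))"
    (is "(\<Sum>\<alpha>\<in>_. F \<alpha> * ?T \<alpha>) = _")
proof -
  \<comment> \<open>\<open>S\<close> collects the \<alpha> whose product has no zero factor;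
    \<open>sel\<close> recovers the matching from such an \<alpha> and will be inverse to
    \<open>family\<close>.\<close>
  define S where "S = {\<alpha> \<in> bij_families k U. \<forall>v\<in>U k. tuple_at k \<alpha> v ` {1..k} \<in> edge ` I}"
  define sel where "sel \<alpha> = {e \<in> I. \<forall>j\<in>{1..<k}. x j e = \<alpha> j (x k e)}" for \<alpha>
  have kk: "k \<in> {1..k}" using k_pos by simp
  have sel_ex: "\<exists>e\<in>sel \<alpha>. x k e = v" if "\<alpha> \<in> S" "v \<in> U k" for \<alpha> v
  proof -
    obtain e where e: "e \<in> I" "tuple_at k \<alpha> v ` {1..k} = edge e"
      using \<open>\<alpha> \<in> S\<close> \<open>v \<in> U k\<close> unfolding S_def by blast
    then have "\<forall>i\<in>{1..k}. tuple_at k \<alpha> v i = x i e"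
      using edge_eq_iff tuple_at_in that unfolding S_def by blast
    then have "x k e = v" "\<forall>j\<in>{1..<k}. \<alpha> j v = x j e"
      using kk by (auto simp: tuple_at_def split: if_splits)
    then show ?thesis using e unfolding sel_def by auto
  qed
  have bij_k: "bij_betw (x k) (sel \<alpha>) (U k)" if "\<alpha> \<in> S" for \<alpha>
  proof (rule bij_betw_imageI)
    show "inj_on (x k) (sel \<alpha>)"
    proof (rule inj_onI, rule coord_inj)
      fix e f i assume *: "e \<in> sel \<alpha>" "f \<in> sel \<alpha>" "x k e = x k f" "i \<in> {1..k}"
      then show "x i e = x i f" by (cases "i = k") (auto simp: sel_def)
    qed (auto simp: sel_def)
    show "x k ` sel \<alpha> = U k"
      using sel_ex[OF that] coord_in[OF kk] unfolding sel_def by blast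
  qed
  have sel_matching: "matching (sel \<alpha>)" if "\<alpha> \<in> S" for \<alpha>
    unfolding matching_def
  proof (intro conjI ballI)
    show "sel \<alpha> \<subseteq> I" by (auto simp: sel_def)
    fix i assume i: "i \<in> {1..k}"
    show "bij_betw (x i) (sel \<alpha>) (U i)"
    proof (cases "i = k")
      case False
      then have "bij_betw (\<alpha> i) (U k) (U i)"
        using that i unfolding S_def bij_families_def by (auto simp: PiE_iff)
      then have "bij_betw (\<alpha> i \<circ> x k) (sel \<alpha>) (U i)"
        using bij_betw_trans bij_k[OF that] by blast
      then show ?thesis
        using i False by (subst bij_betw_cong[where g = "\<alpha> i \<circ> x k"]) (auto simp: sel_def)
    qed (use bij_k that in simp)
  qed
  have family_sel: "family (sel \<alpha>) = \<alpha>" if "\<alpha> \<in> S" for \<alpha>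
  proof -
    have "family (sel \<alpha>) j v = \<alpha> j v" if "j \<in> {1..<k}" "v \<in> U k" for j v
    proof -
      obtain e where e: "e \<in> sel \<alpha>" "x k e = v" using sel_ex[OF \<open>\<alpha> \<in> S\<close> \<open>v \<in> U k\<close>] by blast
      then show ?thesis
        using family_apply[OF sel_matching[OF \<open>\<alpha> \<in> S\<close>] e(1) \<open>j \<in> _\<close>] \<open>j \<in> _\<close>
        by (auto simp: sel_def)
    qed
    moreover have "\<alpha> \<in> bij_families k U" "family (sel \<alpha>) \<in> bij_families k U"
      using that family_in sel_matching by (auto simp: S_def)
    \<comment> \<open>Both sides are extensional in the index and in the vertex, so agreement on
      \<open>{1..<k}\<close> and \<open>U k\<close> is equality.\<close>
    ultimately show ?thesis
      unfolding bij_families_def by (intro PiE_ext) (auto simp: PiE_iff intro!: extensionalityI)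
  qed
  have family_edge: "tuple_at k (family J) (x k e) ` {1..k} = edge e" if "matching J" "e \<in> J" for J e
  proof -
    have "tuple_at k (family J) (x k e) i = x i e" if "i \<in> {1..k}" for i
      using family_apply[OF \<open>matching J\<close> \<open>e \<in> J\<close>] that unfolding tuple_at_def by auto
    then show ?thesis unfolding edge_def by simp
  qed
  have family_S: "family J \<in> S" if "matching J" for J
  proof -
    have "tuple_at k (family J) v ` {1..k} \<in> edge ` I" if "v \<in> U k" for v
    proof -
      have "v \<in> x k ` J"
        using \<open>matching J\<close> \<open>v \<in> U k\<close> kk unfolding matching_def bij_betw_def by simp
      then obtain e where "e \<in> J" "x k e = v" by blast
      then show ?thesis using family_edge \<open>matching J\<close> unfolding matching_def by blast
    qed
    then show ?thesis using family_in[OF that] unfolding S_def by blast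
  qed
  have sel_family: "sel (family J) = J" if "matching J" for J
  proof
    have J: "J \<subseteq> I" using that unfolding matching_def by blast
    show "J \<subseteq> sel (family J)" using J family_apply[OF that] unfolding sel_def by auto
    show "sel (family J) \<subseteq> J"
    proof
      fix e assume e: "e \<in> sel (family J)"
      then have "x k e \<in> U k" using coord_in kk unfolding sel_def by blast
      then have "x k e \<in> x k ` J"
        using \<open>matching J\<close> kk unfolding matching_def bij_betw_def by simp
      then obtain f where f: "f \<in> J" "x k f = x k e" by (metis imageE)
      then have "f = e"
        using bij_k[OF family_S[OF that]] e \<open>J \<subseteq> sel (family J)\<close>
        unfolding bij_betw_def inj_on_def by blast
      then show "e \<in> J" using f by simp
    qed
  qed
  have zero: "?T \<alpha> = 0" if "\<alpha> \<in> bij_families k U - S" for \<alpha>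
  proof -
    obtain v where "v \<in> U k" "tuple_at k \<alpha> v ` {1..k} \<notin> edge ` I"
      using \<open>\<alpha> \<in> _\<close> unfolding S_def by blast
    then show ?thesis
      using finite_part[OF kk] by (intro prod_zero) (auto simp: transition_matrix_def)
  qed
  have T_family: "?T (family J) = (\<Prod>e\<in>J. Poly_Mapping.single (w (edge e)) 1)" if "matching J" for J
  proof -
    have "bij_betw (x k) J (U k)" "J \<subseteq> I" using that kk unfolding matching_def by blast+
    then show ?thesis
      by (subst prod.reindex_bij_betw[symmetric, of "x k" J])
        (auto intro!: prod.cong simp: transition_matrix_def family_edge[OF that] simp del: One_nat_def)
  qed
  have "(\<Sum>\<alpha>\<in>bij_families k U. F \<alpha> * ?T \<alpha>) = (\<Sum>\<alpha>\<in>S. F \<alpha> * ?T \<alpha>)"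
    by (rule sum.mono_neutral_right) (use zero finite_bij_families in \<open>auto simp: S_def\<close>)
  also have "\<dots> = (\<Sum>J | matching J. F (family J) * (\<Prod>e\<in>J. Poly_Mapping.single (w (edge e)) 1))"
  proof (rule sum.reindex_bij_witness[where i = family and j = sel])
    fix \<alpha> assume "\<alpha> \<in> S"
    then show "F (family (sel \<alpha>)) * (\<Prod>e\<in>sel \<alpha>. Poly_Mapping.single (w (edge e)) 1) = F \<alpha> * ?T \<alpha>"
      using T_family[OF sel_matching] family_sel by simp
  qed (use family_sel sel_family family_S sel_matching in simp_all)
  finally show ?thesis .
qed

lemma hyper_per_transition_matrix:
  "hyper_per k U (transition_matrix k (edge ` I) w) =
    (\<Sum>J | matching J. \<Prod>e\<in>J. Poly_Mapping.single (w (edge e)) 1)"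
  using sum_bij_families[of "\<lambda>_. 1" w] unfolding hyper_per_def by simp

end

section \<open>Signs of bijections\<close>

text \<open>Names the permutation inside \<open>bij_sign\<close>, so that it can be composed and
  shown to permute.\<close>

definition rank_perm :: "'a::linorder set \<Rightarrow> 'a set \<Rightarrow> ('a \<Rightarrow> 'a) \<Rightarrow> nat \<Rightarrow> nat" where
  "rank_perm A B f i = (if i < card A then rank_in B (f (sorted_list_of_set A ! i)) else i)"

lemma bij_sign_rank_perm: "bij_sign A B f = sign (rank_perm A B f)"
  unfolding bij_sign_def rank_perm_def ..

text \<open>The elements below the \<open>i\<close>-th entry of the sorted list are its first
  \<open>i\<close> entries. Hence ranking inverts indexing.\<close>

lemma rank_in_nth:
  assumes "finite A" "i < card A"
  shows "rank_in A (sorted_list_of_set A ! i) = i"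
proof -
  let ?xs = "sorted_list_of_set A"
  have len: "length ?xs = card A" by simp
  have sorted: "sorted_wrt (<) ?xs" by simp
  have less_iff: "?xs ! j < ?xs ! l \<longleftrightarrow> j < l" if "j < card A" "l < card A" for j l
    using that sorted_wrt_nth_less[OF sorted] len by (metis less_asym linorder_neqE_nat order_less_irrefl)
  have "{y \<in> A. y < ?xs ! i} = (\<lambda>j. ?xs ! j) ` {..<i}"
  proof (intro set_eqI iffI)
    fix y assume y: "y \<in> {y \<in> A. y < ?xs ! i}"
    then have "y \<in> set ?xs" using assms(1) by simp
    then obtain j where "j < card A" "y = ?xs ! j" using len by (metis in_set_conv_nth)
    then show "y \<in> (\<lambda>j. ?xs ! j) ` {..<i}" using y less_iff assms(2) by auto
  next
    fix y assume "y \<in> (\<lambda>j. ?xs ! j) ` {..<i}"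
    then obtain j where "j < i" "y = ?xs ! j" by auto
    then show "y \<in> {y \<in> A. y < ?xs ! i}"
      using assms less_iff nth_mem[of j ?xs] by simp
  qed
  moreover have "inj_on (\<lambda>j. ?xs ! j) {..<i}"
    using assms(2) by (auto simp: inj_on_def nth_eq_iff_index_eq)
  ultimately show ?thesis unfolding rank_in_def by (simp add: card_image)
qed

lemma bij_betw_nth_sorted_list_of_set:
  "finite A \<Longrightarrow> bij_betw (\<lambda>i. sorted_list_of_set A ! i) {..<card A} A"
  by (rule bij_betw_nth) simp_all

lemma nth_sorted_list_of_set_in: "finite A \<Longrightarrow> i < card A \<Longrightarrow> sorted_list_of_set A ! i \<in> A"
  using bij_betw_nth_sorted_list_of_set by (metis bij_betwE lessThan_iff)

lemma bij_betw_rank_in: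
  assumes "finite A"
  shows "bij_betw (rank_in A) A {..<card A}"
proof -
  note b = bij_betw_nth_sorted_list_of_set[OF assms]
  have "bij_betw (rank_in A \<circ> (\<lambda>i. sorted_list_of_set A ! i)) {..<card A} {..<card A}"
    by (subst bij_betw_cong[where g = id]) (simp_all add: rank_in_nth[OF assms])
  then show ?thesis using bij_betw_comp_iff[OF b] by blast
qed

lemma nth_rank_in: "finite A \<Longrightarrow> x \<in> A \<Longrightarrow> sorted_list_of_set A ! rank_in A x = x"
  using bij_betw_nth_sorted_list_of_set[of A] rank_in_nth[of A]
  unfolding bij_betw_def by (metis (mono_tags, lifting) imageE lessThan_iff)

lemma rank_perm_permutes:
  assumes "finite A" "finite B" "bij_betw f A B"
  shows "rank_perm A B f permutes {..<card A}"
proof (rule bij_imp_permutes)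
  have "bij_betw (rank_in B \<circ> (f \<circ> (\<lambda>i. sorted_list_of_set A ! i))) {..<card A} {..<card B}"
    using assms by (intro bij_betw_trans[where B = B] bij_betw_trans[where B = A]
      bij_betw_nth_sorted_list_of_set bij_betw_rank_in)
  then show "bij_betw (rank_perm A B f) {..<card A} {..<card A}"
    using bij_betw_same_card[OF assms(3)]
    by (subst bij_betw_cong[where g = "rank_in B \<circ> (f \<circ> (\<lambda>i. sorted_list_of_set A ! i))"])
      (auto simp: rank_perm_def)
qed (simp add: rank_perm_def)

text \<open>Ranking in \<open>B\<close> and listing \<open>B\<close> in order cancel in the middle,
  so the rank permutations compose, and \<open>sign\<close> is multiplicative.\<close>

lemma bij_sign_compose:
  assumes "finite A" "bij_betw f A B" "bij_betw g B C"
  shows "bij_sign A C (g \<circ> f) = bij_sign B C g * bij_sign A B f"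
proof -
  have fin: "finite B" "finite C" and card: "card B = card A"
    using assms bij_betw_finite bij_betw_same_card by metis+
  have "rank_perm A C (g \<circ> f) = rank_perm B C g \<circ> rank_perm A B f"
  proof
    fix i
    show "rank_perm A C (g \<circ> f) i = (rank_perm B C g \<circ> rank_perm A B f) i"
    proof (cases "i < card A")
      case True
      then have "f (sorted_list_of_set A ! i) \<in> B"
        using bij_betw_nth_sorted_list_of_set[OF assms(1)] assms(2) unfolding bij_betw_def by auto
      then show ?thesis
        using True card fin bij_betw_rank_in[of B] nth_rank_in[of B]
        unfolding rank_perm_def bij_betw_def by auto
    qed (simp add: rank_perm_def card)
  qed
  then show ?thesis
    unfolding bij_sign_rank_perm using rank_perm_permutes assms fin
    by (metis finite_lessThan permutes_imp_permutation sign_compose)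
qed

lemma bij_sign_cong:
  assumes "finite A" "\<And>x. x \<in> A \<Longrightarrow> f x = g x"
  shows "bij_sign A B f = bij_sign A B g"
proof -
  have "rank_perm A B f = rank_perm A B g"
    using assms by (intro ext) (simp add: rank_perm_def nth_sorted_list_of_set_in)
  then show ?thesis unfolding bij_sign_rank_perm by simp
qed

text \<open>An order isomorphism preserves ranks, so its rank permutation is the identity.\<close>

lemma bij_sign_strict_mono:
  assumes "finite A" "bij_betw f A B" "strict_mono_on A f"
  shows "bij_sign A B f = 1"
proof -
  have "rank_in B (f x) = rank_in A x" if "x \<in> A" for x
  proof -
    have "{y \<in> B. y < f x} = f ` {y \<in> A. y < x}"
      using assms(2,3) that unfolding bij_betw_def
      by (auto simp: strict_mono_on_less)
    moreover have "inj_on f {y \<in> A. y < x}"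
      using assms(2) unfolding bij_betw_def by (auto intro: inj_on_subset)
    ultimately show ?thesis unfolding rank_in_def by (simp add: card_image)
  qed
  then have "rank_perm A B f = id"
    using assms(1) by (intro ext) (simp add: rank_perm_def nth_sorted_list_of_set_in rank_in_nth)
  then show ?thesis unfolding bij_sign_rank_perm by (simp add: sign_id)
qed

lemma bij_sign_square: "bij_sign A B f * bij_sign A B f = 1"
  unfolding bij_sign_def by (simp add: sign_idempotent)

text \<open>Pairing the parts as (1,2) and (3,4), the product of the three signs compares the bijections
  that a perfect matching induces from part 1 to part 2 and from part 3 to part 4; these are
  conjugate under the symmetry.\<close>

lemma hyper_det_eq_hyper_per:
  fixes U :: "nat \<Rightarrow> 'a::linorder set" and \<theta> :: "'a \<Rightarrow> 'a"
  assumes "indexed_hypergraph 4 U I x"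
    and bij13: "bij_betw \<theta> (U 1) (U 3)" and bij24: "bij_betw \<theta> (U 2) (U 4)"
    and mono: "strict_mono \<theta>"
    and sym: "\<And>J e. indexed_hypergraph.matching 4 U I x J \<Longrightarrow> e \<in> J \<Longrightarrow>
      \<exists>f\<in>J. x 3 f = \<theta> (x 1 e) \<and> x 4 f = \<theta> (x 2 e)"
  shows "hyper_det 4 U (transition_matrix 4 (indexed_hypergraph.edge 4 x ` I) w) =
    hyper_per 4 U (transition_matrix 4 (indexed_hypergraph.edge 4 x ` I) w)"
proof -
  interpret indexed_hypergraph 4 U I x by fact
  have sign: "(\<Prod>j\<in>{1..<4}. of_int (bij_sign (U 4) (U j) (family J j))) = (1 :: real \<Rightarrow>\<^sub>0 int)"
    if J: "matching J" for J
  proof -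
    let ?\<alpha> = "family J"
    have fin: "finite (U i)" if "i \<in> {1..4}" for i using finite_part that .
    have bij: "bij_betw (?\<alpha> j) (U 4) (U j)" if "j \<in> {1..<4}" for j
      using family_in[OF J] that unfolding bij_families_def by (auto simp: PiE_iff)
    \<comment> \<open>The conjugation relation. If \<open>v\<close> is the vertex of
      \<open>e\<close> in part 4 and \<open>f\<close> is the mirror image of \<open>e\<close>, then
      \<open>\<theta> (x 2 e)\<close> is the vertex of \<open>f\<close> in part 4, and the third
      bijection sends it to \<open>x 3 f\<close>, that is, to
      \<open>\<theta> (x 1 e)\<close>.\<close>
    have "(\<theta> \<circ> ?\<alpha> 1) v = (?\<alpha> 3 \<circ> (\<theta> \<circ> ?\<alpha> 2)) v" if "v \<in> U 4" for v
    proof -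
      have "v \<in> x 4 ` J" using J that unfolding matching_def bij_betw_def by simp
      then obtain e where e: "e \<in> J" "v = x 4 e" by blast
      obtain f where f: "f \<in> J" "x 3 f = \<theta> (x 1 e)" "x 4 f = \<theta> (x 2 e)"
        using sym[OF J e(1)] by blast
      show ?thesis
        using family_apply[OF J e(1), of 1] family_apply[OF J e(1), of 2]
          family_apply[OF J f(1), of 3] e f by simp
    qed
    then have "bij_sign (U 4) (U 3) (\<theta> \<circ> ?\<alpha> 1) = bij_sign (U 4) (U 3) (?\<alpha> 3 \<circ> (\<theta> \<circ> ?\<alpha> 2))"
      by (intro bij_sign_cong fin) simp_all
    moreover have "bij_sign (U 1) (U 3) \<theta> = 1" "bij_sign (U 2) (U 4) \<theta> = 1"
      using bij13 bij24 fin mono by (auto intro!: bij_sign_strict_mono simp: strict_mono_on_def strict_mono_def)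
    moreover have "bij_sign (U 4) (U 3) (\<theta> \<circ> ?\<alpha> 1) = bij_sign (U 1) (U 3) \<theta> * bij_sign (U 4) (U 1) (?\<alpha> 1)"
      using fin bij bij13 by (intro bij_sign_compose) auto
    moreover have "bij_sign (U 4) (U 3) (?\<alpha> 3 \<circ> (\<theta> \<circ> ?\<alpha> 2)) =
        bij_sign (U 4) (U 3) (?\<alpha> 3) * bij_sign (U 4) (U 4) (\<theta> \<circ> ?\<alpha> 2)"
      using fin bij bij24 by (intro bij_sign_compose bij_betw_trans[of "?\<alpha> 2" _ "U 2"]) auto
    moreover have "bij_sign (U 4) (U 4) (\<theta> \<circ> ?\<alpha> 2) = bij_sign (U 2) (U 4) \<theta> * bij_sign (U 4) (U 2) (?\<alpha> 2)"
      using fin bij bij24 by (intro bij_sign_compose) auto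
    \<comment> \<open>As \<theta> has sign 1 on both pairs of parts, only the signs of the three
      bijections remain; their product is then the square of a sign.\<close>
    ultimately have eq: "bij_sign (U 4) (U 1) (?\<alpha> 1) =
        bij_sign (U 4) (U 3) (?\<alpha> 3) * bij_sign (U 4) (U 2) (?\<alpha> 2)"
      by simp
    have "{1..<4} = {1, 2, 3 :: nat}" by auto
    then have "(\<Prod>j\<in>{1..<4}. bij_sign (U 4) (U j) (?\<alpha> j)) =
        bij_sign (U 4) (U 1) (?\<alpha> 1) * (bij_sign (U 4) (U 3) (?\<alpha> 3) * bij_sign (U 4) (U 2) (?\<alpha> 2))"
      by simp
    also have "\<dots> = 1" unfolding eq[symmetric] by (rule bij_sign_square)
    finally show ?thesis by (metis of_int_1 of_int_prod)
  qed
  show ?thesis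
    \<comment> \<open>Both sides become sums over matchings; they differ only in the product of
      signs, which is 1.\<close>
    unfolding hyper_det_def hyper_per_transition_matrix sum_bij_families
    by (intro sum.cong refl) (use sign in simp)
qed

section \<open>The gadgets\<close>

definition code :: "nat \<Rightarrow> nat \<Rightarrow> nat" where
  "code c v = 12 * v + c"

lemma code_eq_iff: "c < 12 \<Longrightarrow> c' < 12 \<Longrightarrow> code c v = code c' v' \<longleftrightarrow> c = c' \<and> v = v'"
  unfolding code_def by (metis add.commute div_mult_self4 mod_less mod_mult_self2 add_right_imp_eq mult_cancel1 zero_neq_numeral)

text \<open>The entry of \<open>slot\<close> for part \<open>i\<close> and row \<open>r\<close> is the part of \<open>H\<close> whose vertex is copied
  (1, 2, 3), or 4 for the private vertex \<open>p\<close>, or 5 for \<open>q\<close>. The number of a vertex is \<open>12 v + c\<close>, where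
  the twelve codes \<open>c\<close> separate the parts and the three kinds of vertices.\<close>

definition slot :: "nat \<Rightarrow> nat \<Rightarrow> nat" where
  "slot i r = [[4, 5, 1, 4, 3, 5],
               [4, 5, 3, 5, 2, 4],
               [4, 5, 4, 1, 5, 3],
               [4, 5, 5, 3, 4, 2]] ! (i - 1) ! r"

text \<open>All three codes of part \<open>i\<close> are congruent to \<open>i - 1\<close> modulo 4,
  and passing from part \<open>i\<close> to part \<open>i + 2\<close> adds 2. Both sorts of copies
  share a code, since the numbers of the copied vertices already differ.\<close>

definition slot_kind :: "nat \<Rightarrow> nat \<Rightarrow> nat" where
  "slot_kind i t = (if t = 4 then 3 + i else if t = 5 then 7 + i else i - 1)"

text \<open>The part of \<open>H\<close> that is copied into part \<open>i\<close> alongside part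
  3.\<close>

definition mate :: "nat \<Rightarrow> nat" where
  "mate i = (if i = 1 \<or> i = 3 then 1 else 2)"

text \<open>The permutation of the rows induced by exchanging parts 1 with 3 and 2 with 4.\<close>

definition swap_row :: "nat \<Rightarrow> nat" where
  "swap_row r = [0, 1, 3, 2, 5, 4] ! r"

lemma small_intervals:
  "{1..4} = {1, 2, 3, 4 :: nat}" "{..<6} = {0, 1, 2, 3, 4, 5 :: nat}" "{2..<6} = {2, 3, 4, 5 :: nat}"
  by auto

lemma slot_simps:
  "slot 1 0 = 4" "slot 1 1 = 5" "slot 1 2 = 1" "slot 1 3 = 4" "slot 1 4 = 3" "slot 1 5 = 5"
  "slot 2 0 = 4" "slot 2 1 = 5" "slot 2 2 = 3" "slot 2 3 = 5" "slot 2 4 = 2" "slot 2 5 = 4"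
  "slot 3 0 = 4" "slot 3 1 = 5" "slot 3 2 = 4" "slot 3 3 = 1" "slot 3 4 = 5" "slot 3 5 = 3"
  "slot 4 0 = 4" "slot 4 1 = 5" "slot 4 2 = 5" "slot 4 3 = 3" "slot 4 4 = 4" "slot 4 5 = 2"
  by (simp_all add: slot_def)

text \<open>By exhaustion of the table. In each column, rows 0 and 1 supply \<open>p\<close> and
  \<open>q\<close>, and rows 2 to 5 supply each of the four kinds once; this makes the two halves
  alternatives.\<close>

lemma slot_table: "\<forall>i\<in>{1..4}.
    (\<forall>r\<in>{..<6}. slot i r \<in> {3, mate i, 4, 5}) \<and>
    slot i 0 = 4 \<and> slot i 1 = 5 \<and>
    (\<exists>a\<in>{2..<6}. slot i a = 4) \<and> (\<exists>a\<in>{2..<6}. slot i a = 5) \<and>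
    (\<exists>a\<in>{2..<6}. slot i a = 3) \<and> (\<exists>a\<in>{2..<6}. slot i a = mate i) \<and>
    (\<forall>r\<in>{2..<6}. \<forall>r'\<in>{2..<6}. slot i r = slot i r' \<longrightarrow> r = r')"
  unfolding small_intervals by (simp add: slot_simps mate_def swap_row_def del: One_nat_def)

text \<open>These private vertices tie each of rows 2 to 5 to row 0 and to row 1.\<close>

lemma slot_internal: "\<forall>r\<in>{2..<6}. (\<exists>i\<in>{1..4}. slot i r = 4) \<and> (\<exists>i\<in>{1..4}. slot i r = 5)"
  unfolding small_intervals by (simp add: slot_simps mate_def swap_row_def del: One_nat_def)

text \<open>The combinatorial core of almost disjointness: two columns identify the row, and two
  copies in one row come from different parts of \<open>H\<close>, so that almost disjointness of
  \<open>H\<close> can be applied to them.\<close>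

lemma slot_two: "\<forall>r\<in>{..<6}. \<forall>r'\<in>{..<6}. \<forall>i\<in>{1..4}. \<forall>i'\<in>{1..4}.
    i \<noteq> i' \<and> slot i r = slot i r' \<and> slot i' r = slot i' r' \<longrightarrow>
    r = r' \<and> (slot i r < 4 \<and> slot i' r < 4 \<longrightarrow> slot i r \<noteq> slot i' r)"
  unfolding small_intervals by (simp add: slot_simps mate_def swap_row_def del: One_nat_def)

lemma slot_swap: "\<forall>r\<in>{..<6}. swap_row r < 6 \<and> (2 \<le> swap_row r \<longleftrightarrow> 2 \<le> r) \<and>
    slot 3 (swap_row r) = slot 1 r \<and> slot 4 (swap_row r) = slot 2 r"
  unfolding small_intervals by (simp add: slot_simps mate_def swap_row_def del: One_nat_def)


lemma slot_cases:
  assumes "i \<in> {1..4}" "r < 6"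
  obtains "slot i r = 3" | "slot i r = mate i" | "slot i r = 4" | "slot i r = 5"
  using slot_table assms by blast

lemma mate_in: "mate i \<in> {1, 2}"
  by (simp add: mate_def)

lemma slot_in:
  assumes "i \<in> {1..4}" "r < 6"
  shows "slot i r \<in> {1..5}"
  using assms mate_in[of i] by (cases rule: slot_cases) auto

lemma slot_less_4D:
  assumes "i \<in> {1..4}" "slot i r < 4"
  shows "2 \<le> r"
proof (rule ccontr)
  assume "\<not> 2 \<le> r"
  then have "r = 0 \<or> r = 1" by arith
  then show False using slot_table assms by auto
qed

lemma slot_position:
  assumes "i \<in> {1..4}" "t \<in> {3, mate i, 4, 5}"
  obtains a where "2 \<le> a" "a < 6" "slot i a = t"
proof -
  have "\<exists>a\<in>{2..<6}. slot i a = t" using assms slot_table by blast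
  then show ?thesis using that by auto
qed

lemma slot_inj:
  assumes "i \<in> {1..4}" "2 \<le> r" "2 \<le> r'" "r < 6" "r' < 6" "slot i r = slot i r'"
  shows "r = r'"
  using assms slot_table by (meson atLeastLessThan_iff)

lemma slot_inj_low:
  assumes "i \<in> {1..4}" "r < 2" "r' < 2" "slot i r = slot i r'"
  shows "r = r'"
proof -
  have "slot i 0 = 4" "slot i 1 = 5" using slot_table assms(1) by blast+
  moreover have "r = 0 \<or> r = 1" "r' = 0 \<or> r' = 1" using assms by arith+
  ultimately show ?thesis using assms(4) by auto
qed

section \<open>The 4-partite hypergraph assembled from the gadgets\<close>

text \<open>\<open>H\<close> with vertices written as numbers: \<open>W t\<close> is part
  \<open>t\<close>, and \<open>X t j\<close> is the vertex of hyperedge \<open>j\<close> in it.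
  \<open>linear\<close> is almost disjointness in coordinates.\<close>

locale gadgets = indexed_hypergraph 3 W "{..<m}" X
  for m :: nat and W :: "nat \<Rightarrow> nat set" and X :: "nat \<Rightarrow> nat \<Rightarrow> nat" +
  assumes linear: "j < m \<Longrightarrow> j' < m \<Longrightarrow> t \<in> {1..3} \<Longrightarrow> t' \<in> {1..3} \<Longrightarrow> t \<noteq> t' \<Longrightarrow>
    X t j = X t j' \<Longrightarrow> X t' j = X t' j' \<Longrightarrow> j = j'"
begin

text \<open>The pair \<open>(j, r)\<close> stands for row \<open>r\<close> of the gadget that
  replaces hyperedge \<open>j\<close>.\<close>

definition rows :: "(nat \<times> nat) set" where
  "rows = {..<m} \<times> {..<6}"

definition coord :: "nat \<Rightarrow> nat \<times> nat \<Rightarrow> nat" where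
  "coord i e = (let t = slot i (snd e) in code (slot_kind i t) (if t < 4 then X t (fst e) else fst e))"

definition part :: "nat \<Rightarrow> nat set" where
  "part i = code (i - 1) ` (W 3 \<union> W (mate i)) \<union> code (3 + i) ` {..<m} \<union> code (7 + i) ` {..<m}"

text \<open>The matching that corresponds to \<open>J\<close>: gadgets in \<open>J\<close> use rows
  2 to 5, the others rows 0 and 1.\<close>

definition covering :: "nat set \<Rightarrow> (nat \<times> nat) set" where
  "covering J = {e \<in> rows. 2 \<le> snd e \<longleftrightarrow> fst e \<in> J}"

lemma X_in: "t \<in> {1..3} \<Longrightarrow> j < m \<Longrightarrow> X t j \<in> W t"
  using coord_in by simp

lemma X_eq_imp: "X t j = X t' j' \<Longrightarrow> j < m \<Longrightarrow> j' < m \<Longrightarrow> t \<in> {1..3} \<Longrightarrow> t' \<in> {1..3} \<Longrightarrow> t = t'"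
  using part_unique X_in by metis

text \<open>Different kinds have different codes, except the two sorts of copies; those are
  separated by the disjointness of the parts of \<open>H\<close>.\<close>

lemma coord_eq_iff:
  assumes "i \<in> {1..4}" "e \<in> rows" "f \<in> rows"
  shows "coord i e = coord i f \<longleftrightarrow> slot i (snd e) = slot i (snd f) \<and>
    (if slot i (snd e) < 4 then X (slot i (snd e)) (fst e) = X (slot i (snd e)) (fst f)
     else fst e = fst f)"
proof -
  have *: "slot i (snd e) \<in> {1..5}" "slot i (snd f) \<in> {1..5}" "fst e < m" "fst f < m" "1 \<le> i" "i \<le> 4"
    using assms slot_in unfolding rows_def by auto
  have **: "slot_kind i (slot i (snd e)) < 12" "slot_kind i (slot i (snd f)) < 12"
    using * by (auto simp: slot_kind_def)
  consider "slot i (snd e) < 4" "slot i (snd f) < 4" | "slot i (snd e) \<ge> 4 \<or> slot i (snd f) \<ge> 4"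
    by linarith
  then show ?thesis
  proof cases
    case 1
    then show ?thesis
      using * ** X_eq_imp[of "slot i (snd e)" "fst e" "slot i (snd f)" "fst f"]
      unfolding coord_def Let_def by (auto simp: code_eq_iff slot_kind_def)
  next
    case 2
    then show ?thesis
      using * ** unfolding coord_def Let_def by (auto simp: code_eq_iff slot_kind_def)
  qed
qed

lemma coord_in_part:
  assumes "i \<in> {1..4}" "e \<in> rows"
  shows "coord i e \<in> part i"
proof -
  have *: "fst e < m" "snd e < 6" using assms unfolding rows_def by auto
  have "mate i \<in> {1..3}" using mate_in[of i] by auto
  then show ?thesis
    using assms(1) * X_in[of 3 "fst e"] X_in[of "mate i" "fst e"] mate_in[of i]
    by (cases rule: slot_cases[OF assms(1) *(2)])
      (auto simp: coord_def part_def slot_kind_def)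
qed

text \<open>As 4 divides 12, the residue of a vertex modulo 4 is that of its code and reveals its
  part.\<close>

lemma part_disjoint: "disjoint_family_on part {1..4}"
proof -
  have code_mod: "code c v mod 4 = c mod 4" for c v unfolding code_def by presburger
  have "part i \<subseteq> {v. v mod 4 = i - 1}" if "i \<in> {1..4}" for i
  proof -
    have "i = 1 \<or> i = 2 \<or> i = 3 \<or> i = 4" using that by auto
    then show ?thesis
      unfolding part_def by (auto simp: code_mod simp del: One_nat_def)
  qed
  then have part_mod: "v mod 4 = i - 1" if "i \<in> {1..4}" "v \<in> part i" for i v using that by blast
  show ?thesis
    unfolding disjoint_family_on_def
  proof (intro ballI impI)
    fix i i' :: nat assume *: "i \<in> {1..4}" "i' \<in> {1..4}" "i \<noteq> i'"
    then have "i - 1 \<noteq> i' - 1" by auto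
    then show "part i \<inter> part i' = {}" using part_mod[OF *(1)] part_mod[OF *(2)] by fastforce
  qed
qed

lemma finite_new_part: "i \<in> {1..4} \<Longrightarrow> finite (part i)"
  unfolding part_def using finite_part mate_in[of i] by auto

text \<open>By \<open>slot_two\<close> the rows agree. A private common vertex names the gadget; two
  common copies come from different parts of \<open>H\<close>, and \<open>linear\<close>
  applies.\<close>

lemma coord_two:
  assumes "e \<in> rows" "f \<in> rows" "i \<in> {1..4}" "i' \<in> {1..4}" "i \<noteq> i'"
    and "coord i e = coord i f" "coord i' e = coord i' f"
  shows "e = f"
proof -
  obtain j r where e: "e = (j, r)" "j < m" "r < 6" using assms(1) unfolding rows_def by auto
  obtain j' r' where f: "f = (j', r')" "j' < m" "r' < 6" using assms(2) unfolding rows_def by auto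
  have 1: "slot i r = slot i r'" "slot i' r = slot i' r'"
    and 2: "if slot i r < 4 then X (slot i r) j = X (slot i r) j' else j = j'"
      "if slot i' r < 4 then X (slot i' r) j = X (slot i' r) j' else j = j'"
    using coord_eq_iff assms e f by auto
  have 3: "r = r'" "slot i r < 4 \<and> slot i' r < 4 \<longrightarrow> slot i r \<noteq> slot i' r"
    using slot_two[THEN bspec, of r, THEN bspec, of r', THEN bspec, of i, THEN bspec, of i']
      1 assms(3-5) e f by (simp_all del: One_nat_def)
  have "j = j'"
  proof (cases "slot i r < 4 \<and> slot i' r < 4")
    case True
    then show ?thesis
      using 2 3 e f slot_in[OF assms(3) e(3)] slot_in[OF assms(4) e(3)]
      by (intro linear[of j j' "slot i r" "slot i' r"]) auto
  qed (use 2 in \<open>auto split: if_splits\<close>)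
  then show ?thesis using e f 3 by simp
qed

sublocale new: indexed_hypergraph 4 part rows coord
proof
  fix e f assume "e \<in> rows" "f \<in> rows" "\<And>i. i \<in> {1..4} \<Longrightarrow> coord i e = coord i f"
  then show "e = f" by (intro coord_two[of e f 1 2]) auto
qed (use finite_new_part part_disjoint coord_in_part in \<open>auto simp: rows_def\<close>)

text \<open>A common vertex occupies the same part in both hyperedges, so two distinct ones give
  agreement in two parts, which \<open>coord_two\<close> excludes.\<close>

lemma almost_disjoint_new: "almost_disjoint (new.edge ` rows)"
  unfolding almost_disjoint_def
proof (intro ballI impI)
  fix A B assume "A \<in> new.edge ` rows" "B \<in> new.edge ` rows" and ne: "A \<noteq> B"
  then obtain e f where ef: "e \<in> rows" "f \<in> rows" "A = new.edge e" "B = new.edge f" by blast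
  have same: "\<exists>i\<in>{1..4}. u = coord i e \<and> u = coord i f" if "u \<in> A \<inter> B" for u
  proof -
    obtain i i' where "i \<in> {1..4}" "i' \<in> {1..4}" "u = coord i e" "u = coord i' f"
      using \<open>u \<in> A \<inter> B\<close> unfolding ef new.edge_def by blast
    then show ?thesis
      using new.part_unique[of u i i'] new.coord_in[of i e] new.coord_in[of i' f] ef by auto
  qed
  have "u = v" if "u \<in> A \<inter> B" "v \<in> A \<inter> B" for u v
    using same[OF that(1)] same[OF that(2)] coord_two ef ne by metis
  moreover have "finite (A \<inter> B)" unfolding ef new.edge_def by simp
  ultimately show "card (A \<inter> B) \<le> 1" by (simp add: card_le_Suc0_iff_eq)
qed

section \<open>Perfect matchings of the new hypergraph\<close>

text \<open>Private vertices are covered exactly once whatever \<open>J\<close> is, so only the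
  copies impose a condition: a copy is covered as often as \<open>J\<close> covers its
  original.\<close>

lemma bij_betw_coord_covering:
  assumes i: "i \<in> {1..4}" and J: "J \<subseteq> {..<m}"
  shows "bij_betw (coord i) (covering J) (part i) \<longleftrightarrow>
    bij_betw (X 3) J (W 3) \<and> bij_betw (X (mate i)) J (W (mate i))" (is "_ \<longleftrightarrow> ?R")
proof
  assume bij: "bij_betw (coord i) (covering J) (part i)"
  have "bij_betw (X t) J (W t)" if t: "t \<in> {3, mate i}" for t
  proof (rule bij_betw_imageI)
    have t': "t \<in> {1..3}" using t mate_in[of i] by auto
    obtain a where a: "2 \<le> a" "a < 6" "slot i a = t" using slot_position[OF i] t by blast
    show "inj_on (X t) J"
    proof (rule inj_onI)
      fix j j' assume *: "j \<in> J" "j' \<in> J" "X t j = X t j'"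
      then have in_cov: "(j, a) \<in> covering J" "(j', a) \<in> covering J"
        using J a unfolding covering_def rows_def by auto
      then have "coord i (j, a) = coord i (j', a)"
        using * a t' unfolding coord_def by auto
      then show "j = j'" using in_cov bij unfolding bij_betw_def inj_on_def by blast
    qed
    show "X t ` J = W t"
    proof
      show "X t ` J \<subseteq> W t" using X_in[OF t'] J by auto
      show "W t \<subseteq> X t ` J"
      proof
        fix u assume u: "u \<in> W t"
        \<comment> \<open>The copy of \<open>u\<close> in part \<open>i\<close>. The hyperedge
          covering it must lie in rows 2 to 5, hence in a gadget of \<open>J\<close>.\<close>
        then have "code (i - 1) u \<in> part i" using t unfolding part_def by auto
        then obtain e where e: "e \<in> covering J" "coord i e = code (i - 1) u"
          using bij unfolding bij_betw_def by (metis imageE)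
        have s: "slot i (snd e) \<in> {1..5}" "fst e < m" "snd e < 6"
          using e slot_in[OF i] unfolding covering_def rows_def by auto
        have c: "slot i (snd e) < 4" "X (slot i (snd e)) (fst e) = u"
          using e(2) s(1) i unfolding coord_def Let_def slot_kind_def
          by (auto simp: code_eq_iff split: if_splits)
        have "slot i (snd e) \<in> {1..3}" using c s(1) by auto
        then have "slot i (snd e) = t" using part_unique[of u] X_in s(2) c(2) u t' by metis
        moreover have "fst e \<in> J" using e(1) slot_less_4D[OF i c(1)] unfolding covering_def by blast
        ultimately show "u \<in> X t ` J" using c by blast
      qed
    qed
  qed
  then show ?R by blast
next
  assume R: ?R
  have inj_X: "j = j'" if "t \<in> {3, mate i}" "X t j = X t j'" "j \<in> J" "j' \<in> J" for t j j'
    using R that unfolding bij_betw_def inj_on_def by blast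
  have img_X: "W t = X t ` J" if "t \<in> {3, mate i}" for t
    using R that unfolding bij_betw_def by blast
  show "bij_betw (coord i) (covering J) (part i)"
  proof (rule bij_betw_imageI)
    show "inj_on (coord i) (covering J)"
    proof (rule inj_onI)
      fix e f assume ef: "e \<in> covering J" "f \<in> covering J" "coord i e = coord i f"
      have rows: "e \<in> rows" "f \<in> rows" using ef unfolding covering_def by auto
      then have less: "snd e < 6" "snd f < 6" unfolding rows_def by auto
      have s: "slot i (snd e) = slot i (snd f)"
        "if slot i (snd e) < 4 then X (slot i (snd e)) (fst e) = X (slot i (snd e)) (fst f)
         else fst e = fst f"
        using ef(3) coord_eq_iff[OF i rows] by auto
      have fst: "fst e = fst f"
      proof (cases "slot i (snd e) < 4")
        case True
        then have "slot i (snd e) \<in> {3, mate i}" using slot_table i less by fastforce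
        moreover have "fst e \<in> J" "fst f \<in> J"
          using ef slot_less_4D[OF i] s(1) True unfolding covering_def by auto
        ultimately show ?thesis
          using inj_X[of "slot i (snd e)" "fst e" "fst f"] s(2) True by simp
      qed (use s in auto)
      \<comment> \<open>A gadget uses only one half of its rows, and within a half a column of
        \<open>slot\<close> has no repetition.\<close>
      then have "2 \<le> snd e \<longleftrightarrow> 2 \<le> snd f" using ef unfolding covering_def by auto
      then have "snd e = snd f"
        using slot_inj[OF i _ _ less s(1)] slot_inj_low[OF i _ _ s(1)] by linarith
      with fst show "e = f" by (simp add: prod_eq_iff)
    qed
    show "coord i ` covering J = part i"
    proof
      show "coord i ` covering J \<subseteq> part i" using coord_in_part[OF i] unfolding covering_def by auto
      have terminal: "code (i - 1) u \<in> coord i ` covering J" if u: "u \<in> W t" "t \<in> {3, mate i}" for u t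
      proof -
        obtain j where j: "j \<in> J" "u = X t j" using img_X u by blast
        obtain a where a: "2 \<le> a" "a < 6" "slot i a = t" using slot_position[OF i] u by blast
        have "(j, a) \<in> covering J" using j a J unfolding covering_def rows_def by auto
        moreover have "coord i (j, a) = code (i - 1) u"
          using a j u(2) mate_in[of i] unfolding coord_def slot_kind_def by auto
        ultimately show ?thesis by (metis imageI)
      qed
      have internal: "code (slot_kind i t) j \<in> coord i ` covering J" if "j < m" "t \<in> {4, 5}" for j t
      proof -
        obtain a where a: "2 \<le> a" "a < 6" "slot i a = t"
          using slot_position[OF i] \<open>t \<in> {4, 5}\<close> by blast
        \<comment> \<open>Row \<open>t - 4\<close> is row 0 for \<open>p\<close> and row 1 for
          \<open>q\<close>; exactly one of it and row \<open>a\<close> belongs to the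
          covering.\<close>
        define b where "b = (if j \<in> J then a else t - 4)"
        have "slot i b = t" "b < 6" "2 \<le> b \<longleftrightarrow> j \<in> J"
          using a that(2) slot_table i unfolding b_def by auto
        then have "(j, b) \<in> covering J" "coord i (j, b) = code (slot_kind i t) j"
          using that unfolding covering_def rows_def coord_def by auto
        then show ?thesis by (metis imageI)
      qed
      show "part i \<subseteq> coord i ` covering J"
        unfolding part_def using terminal internal[of _ 4] internal[of _ 5] by (auto simp: slot_kind_def)
    qed
  qed
qed

text \<open>Together the new parts test all parts of \<open>H\<close>: part 3 in each, part 1 in the
  odd ones, part 2 in the even ones.\<close>

lemma matching_covering_iff:
  assumes "J \<subseteq> {..<m}"
  shows "new.matching (covering J) \<longleftrightarrow> matching J"
proof -
  have "{1..3} = {1, 2, 3 :: nat}" "covering J \<subseteq> rows" by (auto simp: covering_def)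
  then show ?thesis
    using bij_betw_coord_covering[OF _ assms] assms
    unfolding new.matching_def matching_def small_intervals by (auto simp: mate_def)
qed

text \<open>Shared private vertices propagate the choice through a gadget: row 0 excludes or forces
  each of rows 2 to 5 through a \<open>p\<close>, and row 2 in turn decides row 1 through a
  \<open>q\<close>.\<close>

lemma matching_covering:
  assumes M: "new.matching M"
  shows "\<exists>J\<subseteq>{..<m}. M = covering J"
proof -
  have sub: "M \<subseteq> rows" and bij: "\<And>i. i \<in> {1..4} \<Longrightarrow> bij_betw (coord i) M (part i)"
    using M unfolding new.matching_def by auto
  \<comment> \<open>The private vertex of kind \<open>t\<close> in part \<open>i\<close> lies on
    rows \<open>t - 4\<close> and \<open>r\<close> of gadget \<open>j\<close> and on no other
    hyperedge.\<close>
  have excl: "(j, t - 4) \<in> M \<longleftrightarrow> (j, r) \<notin> M"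
    if that: "j < m" "i \<in> {1..4}" "t \<in> {4, 5}" "2 \<le> r" "r < 6" "slot i r = t" for i j r t
  proof -
    note i = that(2)
    have low: "slot i (t - 4) = t" using slot_table that by auto
    have rows: "(j, t - 4) \<in> rows" "(j, r) \<in> rows" using that unfolding rows_def by auto
    have eq: "coord i (j, t - 4) = coord i (j, r)"
      using that low unfolding coord_def by auto
    have "coord i (j, r) \<in> part i" using coord_in_part i rows by blast
    then obtain e where e: "e \<in> M" "coord i e = coord i (j, r)"
      using bij[OF i] unfolding bij_betw_def by (metis imageE)
    then have s: "slot i (snd e) = t" "fst e = j"
      using coord_eq_iff[OF i _ rows(2), of e] sub \<open>t \<in> {4, 5}\<close> \<open>slot i r = t\<close>
      by (auto split: if_splits)
    have "snd e < 6" using e sub unfolding rows_def by auto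
    then have "snd e = t - 4 \<or> snd e = r"
      using slot_inj[OF i, of "snd e" r] slot_inj_low[OF i, of "snd e" "t - 4"] s low that
      by (cases "2 \<le> snd e") auto
    then have "(j, t - 4) \<in> M \<or> (j, r) \<in> M" using e(1) s by (metis prod.collapse)
    moreover have "\<not> ((j, t - 4) \<in> M \<and> (j, r) \<in> M)"
      using bij[OF i] eq that unfolding bij_betw_def inj_on_def by fastforce
    ultimately show ?thesis by blast
  qed
  define J where "J = {j. j < m \<and> (j, 0) \<notin> M}"
  have high: "(j, r) \<in> M \<longleftrightarrow> j \<in> J" if "j < m" "2 \<le> r" "r < 6" for j r
  proof -
    obtain i where "i \<in> {1..4}" "slot i r = 4" using slot_internal \<open>2 \<le> r\<close> \<open>r < 6\<close>
      by (metis atLeastLessThan_iff)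
    then show ?thesis using excl[of j i 4 r] that unfolding J_def by auto
  qed
  have low: "(j, r) \<in> M \<longleftrightarrow> j \<notin> J" if "j < m" "r < 2" for j r
  proof (cases "r = 0")
    case False
    have "(2::nat) \<in> {2..<6}" by simp
    then obtain i where i: "i \<in> {1..4}" "slot i 2 = 5" using slot_internal by blast
    then have "(j, 1) \<in> M \<longleftrightarrow> (j, 2) \<notin> M" using excl[of j i 5 2] i \<open>j < m\<close> by simp
    moreover have "r = 1" using False that by auto
    ultimately show ?thesis using high[of j 2] that by auto
  qed (use that in \<open>auto simp: J_def\<close>)
  show ?thesis
  proof (intro exI conjI set_eqI)
    show "J \<subseteq> {..<m}" unfolding J_def by blast
    fix e :: "nat \<times> nat"
    obtain j r where [simp]: "e = (j, r)" by (cases e)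
    show "e \<in> M \<longleftrightarrow> e \<in> covering J"
      using sub high[of j r] low[of j r] unfolding covering_def rows_def
      by (cases "r < 2") auto
  qed
qed

text \<open>Row 2 of each gadget records membership in \<open>J\<close>, which gives injectivity;
  surjectivity is \<open>matching_covering\<close>.\<close>

lemma bij_betw_covering: "bij_betw covering {J. matching J} {M. new.matching M}"
proof (rule bij_betw_imageI)
  have "J \<subseteq> J'" if "J \<subseteq> {..<m}" "covering J = covering J'" for J J'
  proof
    fix j assume "j \<in> J"
    then have "(j, 2) \<in> covering J" using that(1) unfolding covering_def rows_def by auto
    then have "(j, 2) \<in> covering J'" using that(2) by simp
    then show "j \<in> J'" unfolding covering_def by simp
  qed
  then have "J = J'" if "matching J" "matching J'" "covering J = covering J'" for J J'
    using that unfolding matching_def by (metis subset_antisym)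
  then show "inj_on covering {J. matching J}" by (simp add: inj_on_def)
  show "covering ` {J. matching J} = {M. new.matching M}"
  proof (intro set_eqI iffI)
    fix M assume "M \<in> covering ` {J. matching J}"
    then obtain J where "matching J" "M = covering J" by blast
    then show "M \<in> {M. new.matching M}" using matching_covering_iff[of J] by (simp add: matching_def)
  next
    fix M assume "M \<in> {M. new.matching M}"
    then have M: "new.matching M" by simp
    obtain J where J: "J \<subseteq> {..<m}" "M = covering J" using matching_covering[OF M] by blast
    then have "matching J" using M matching_covering_iff by simp
    then show "M \<in> covering ` {J. matching J}" using J by blast
  qed
qed

section \<open>The symmetry and the value of the determinant\<close>

text \<open>The mirror image stays in the gadget and in the same half. The 2 is the difference of
  the codes of parts 3 and 4 from those of parts 1 and 2.\<close>

lemma covering_swap: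
  assumes "e \<in> covering J"
  shows "\<exists>f\<in>covering J. coord 3 f = coord 1 e + 2 \<and> coord 4 f = coord 2 e + 2"
proof -
  obtain j r where e: "e = (j, r)" "j < m" "r < 6" using assms unfolding covering_def rows_def by auto
  have *: "swap_row r < 6" "2 \<le> swap_row r \<longleftrightarrow> 2 \<le> r"
    "slot 3 (swap_row r) = slot 1 r" "slot 4 (swap_row r) = slot 2 r"
    using slot_swap e by auto
  have "(j, swap_row r) \<in> covering J"
    using * e assms unfolding covering_def rows_def by auto
  moreover have "coord 3 (j, swap_row r) = coord 1 e + 2" "coord 4 (j, swap_row r) = coord 2 e + 2"
    using * e unfolding coord_def slot_kind_def code_def Let_def by auto
  ultimately show ?thesis by blast
qed

lemma hyper_det_new:
  "hyper_det 4 part (transition_matrix 4 (new.edge ` rows) w) =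
    hyper_per 4 part (transition_matrix 4 (new.edge ` rows) w)"
proof (rule hyper_det_eq_hyper_per)
  have "code c v + 2 = code (c + 2) v" for c v by (simp add: code_def)
  then have plus2: "(\<lambda>v. v + 2) ` code c ` A = code (c + 2) ` A" for c A
    by (simp add: image_image)
  have "(\<lambda>v. v + 2) ` part 1 = part 3" "(\<lambda>v. v + 2) ` part 2 = part 4"
    unfolding part_def by (simp_all only: image_Un plus2) (simp_all add: mate_def numeral_eq_Suc)
  then show "bij_betw (\<lambda>v. v + 2) (part 1) (part 3)" "bij_betw (\<lambda>v. v + 2) (part 2) (part 4)"
    by (auto simp: bij_betw_def inj_on_def)
  show "strict_mono (\<lambda>v::nat. v + 2)" by (simp add: strict_mono_def)
  show "\<exists>f\<in>M. coord 3 f = coord 1 e + 2 \<and> coord 4 f = coord 2 e + 2"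
    if "new.matching M" "e \<in> M" for M e
    using matching_covering[OF that(1)] covering_swap that(2) by blast
qed (rule new.indexed_hypergraph_axioms)

text \<open>Row 2 of gadget \<open>j\<close> is in the covering exactly for \<open>j\<close> in
  \<open>J\<close>; all other rows contribute 1.\<close>

lemma prod_covering:
  fixes g :: "nat \<times> nat \<Rightarrow> 'r::comm_monoid_mult"
  assumes "J \<subseteq> {..<m}" "\<And>j r. r \<noteq> 2 \<Longrightarrow> g (j, r) = 1"
  shows "(\<Prod>e\<in>covering J. g e) = (\<Prod>j\<in>J. g (j, 2))"
proof -
  have "finite rows" by (simp add: rows_def)
  then have "(\<Prod>e\<in>covering J. g e) = (\<Prod>e\<in>(\<lambda>j. (j, 2)) ` J. g e)"
  proof (intro prod.mono_neutral_right ballI)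
    fix e assume "e \<in> covering J - (\<lambda>j. (j, 2)) ` J"
    then have "snd e \<noteq> 2" by (cases e) (auto simp: covering_def)
    then show "g e = 1" using assms(2) by (cases e) simp
  qed (use assms(1) in \<open>auto simp: covering_def rows_def\<close>)
  also have "\<dots> = (\<Prod>j\<in>J. g (j, 2))" by (subst prod.reindex) (auto simp: inj_on_def)
  finally show ?thesis .
qed

text \<open>Row 2 of gadget \<open>j\<close> carries the whole weight \<open>wt j\<close>, so a
  covering has the same weight product as its \<open>J\<close>.\<close>

lemma hyper_det_new_eq_sum:
  assumes "\<And>e. e \<in> rows \<Longrightarrow> w' (new.edge e) = (if snd e = 2 then wt (fst e) else 0)"
  shows "hyper_det 4 part (transition_matrix 4 (new.edge ` rows) w') =
    (\<Sum>J | matching J. \<Prod>j\<in>J. Poly_Mapping.single (wt j) 1)"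
proof -
  define g where "g e = (if snd e = 2 then Poly_Mapping.single (wt (fst e)) 1 else (1 :: real \<Rightarrow>\<^sub>0 int))"
    for e :: "nat \<times> nat"
  have g: "Poly_Mapping.single (w' (new.edge e)) 1 = g e" if "e \<in> rows" for e
    using assms[OF that] by (simp add: g_def)
  have "hyper_det 4 part (transition_matrix 4 (new.edge ` rows) w') =
      (\<Sum>M | new.matching M. \<Prod>e\<in>M. Poly_Mapping.single (w' (new.edge e)) 1)"
    unfolding hyper_det_new by (rule new.hyper_per_transition_matrix)
  also have "\<dots> = (\<Sum>M | new.matching M. \<Prod>e\<in>M. g e)"
    using g by (intro sum.cong prod.cong) (auto simp: new.matching_def)
  also have "\<dots> = (\<Sum>J | matching J. \<Prod>e\<in>covering J. g e)"
    by (rule sum.reindex_bij_betw[OF bij_betw_covering, symmetric])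
  also have "\<dots> = (\<Sum>J | matching J. \<Prod>j\<in>J. g (j, 2))"
    by (intro sum.cong refl prod_covering) (auto simp: matching_def g_def)
  finally show ?thesis by (simp add: g_def)
qed

text \<open>This count later turns surjectivity of the list of a part into injectivity.\<close>

lemma card_part:
  assumes "i \<in> {1..4}"
  shows "card (part i) = card (W 3) + card (W (mate i)) + 2 * m"
proof -
  have inj: "inj_on (code c) A" for c A by (auto simp: inj_on_def code_def)
  have fin: "finite (W 3)" "finite (W (mate i))" using finite_part mate_in[of i] by auto
  have "W 3 \<inter> W (mate i) = {}" using part_unique[of _ 3 "mate i"] mate_in[of i] by fastforce
  then have "card (W 3 \<union> W (mate i)) = card (W 3) + card (W (mate i))"
    using fin by (simp add: card_Un_disjoint)
  moreover have "code c ` A \<inter> code c' ` B = {}" if "c < 12" "c' < 12" "c \<noteq> c'" for c c' A B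
    using that by (auto simp: code_eq_iff)
  then have "card (part i) = card (code (i - 1) ` (W 3 \<union> W (mate i))) +
      card (code (3 + i) ` {..<m}) + card (code (7 + i) ` {..<m})"
    unfolding part_def using fin assms
    by (subst card_Un_disjoint card_Un_disjoint, auto simp: code_eq_iff simp del: image_Un)+
  ultimately show ?thesis by (simp add: card_image[OF inj] del: image_Un)
qed

end

section \<open>The program\<close>

primrec seqs :: "com list \<Rightarrow> com" where
  "seqs [] = Skip"
| "seqs (c # cs) = Seq c (seqs cs)"

text \<open>Expressions over input cells and the loop counter; writing output cells cannot change
  their values.\<close>

primrec input_nexp :: "nexp \<Rightarrow> bool" where
  "input_nexp (Lit n) \<longleftrightarrow> True"
| "input_nexp (Reg x) \<longleftrightarrow> x \<in> insert (Tmp 0) (range In)"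
| "input_nexp (Read a i) \<longleftrightarrow> a \<in> range In \<and> input_nexp i"
| "input_nexp (Add i j) \<longleftrightarrow> input_nexp i \<and> input_nexp j"
| "input_nexp (Sub i j) \<longleftrightarrow> input_nexp i \<and> input_nexp j"

primrec input_rexp :: "rexp \<Rightarrow> bool" where
  "input_rexp RZero \<longleftrightarrow> True"
| "input_rexp ROne \<longleftrightarrow> True"
| "input_rexp (RRead a i) \<longleftrightarrow> a \<in> range In \<and> input_nexp i"
| "input_rexp (RAdd x y) \<longleftrightarrow> input_rexp x \<and> input_rexp y"
| "input_rexp (RSub x y) \<longleftrightarrow> input_rexp x \<and> input_rexp y"

definition same_input :: "state \<Rightarrow> state \<Rightarrow> bool" where
  "same_input s s' \<longleftrightarrow> (\<forall>i. reg s' (In i) = reg s (In i) \<and> narr s' (In i) = narr s (In i) \<and>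
     rarr s' (In i) = rarr s (In i))"

lemma same_inputD:
  assumes "same_input s s'"
  shows "reg s' (In i) = reg s (In i)" "narr s' (In i) = narr s (In i)" "rarr s' (In i) = rarr s (In i)"
  using assms by (simp_all add: same_input_def)

text \<open>By \<open>nval_input\<close>, operands of iteration \<open>j\<close> may be evaluated in
  this modified initial state instead of the current one.\<close>

definition at_counter :: "state \<Rightarrow> nat \<Rightarrow> state" where
  "at_counter s j = s\<lparr>reg := (reg s)(Tmp 0 := j)\<rparr>"

lemma at_counter_simps [simp]:
  "reg (at_counter s j) (Tmp 0) = j" "reg (at_counter s j) (In i) = reg s (In i)"
  "narr (at_counter s j) = narr s" "rarr (at_counter s j) = rarr s"
  by (simp_all add: at_counter_def)

lemma nval_input: "input_nexp e \<Longrightarrow> same_input s0 s \<Longrightarrow> nval e s = nval e (at_counter s0 (reg s (Tmp 0)))"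
  by (induction e) (auto simp: same_inputD)

lemma rval_input: "input_rexp e \<Longrightarrow> same_input s0 s \<Longrightarrow> rval e s = rval e (at_counter s0 (reg s (Tmp 0)))"
  by (induction e) (auto simp: same_inputD nval_input)

text \<open>A cell is a position of an array of naturals or of the real output array. Programs are verified
  against a target memory \<open>f\<close>, \<open>g\<close> by tracking the set of cells that hold their target value: since each
  cell has a single target value, this set only grows, and overlapping stores need no attention.\<close>

definition correct :: "(name \<Rightarrow> nat \<Rightarrow> nat) \<Rightarrow> (nat \<Rightarrow> real) \<Rightarrow> state \<Rightarrow> (name \<times> nat + nat) set" where
  "correct f g s = Inl ` {(a, i). narr s a i = f a i} \<union> Inr ` {i. rarr s (Out 0) i = g i}"

primrec cell :: "state \<Rightarrow> com \<Rightarrow> name \<times> nat + nat" where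
  "cell s (Store a i e) = Inl (a, nval i s)"
| "cell s (RStore a i e) = Inr (nval i s)"

text \<open>Meant for a state \<open>at_counter s0 j\<close>, so that it can be checked without
  running the program.\<close>

primrec good :: "(name \<Rightarrow> nat \<Rightarrow> nat) \<Rightarrow> (nat \<Rightarrow> real) \<Rightarrow> state \<Rightarrow> com \<Rightarrow> bool" where
  "good f g s Skip \<longleftrightarrow> False"
| "good f g s (Assign x e) \<longleftrightarrow> False"
| "good f g s (Store a i e) \<longleftrightarrow> a \<in> range Out \<and> input_nexp i \<and> input_nexp e \<and> nval e s = f a (nval i s)"
| "good f g s (RStore a i e) \<longleftrightarrow> a = Out 0 \<and> input_nexp i \<and> input_rexp e \<and> rval e s = g (nval i s)"
| "good f g s (Seq c d) \<longleftrightarrow> False"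
| "good f g s (If b c d) \<longleftrightarrow> False"
| "good f g s (While b c) \<longleftrightarrow> False"

text \<open>The operands evaluate as in the initial state with the current counter, so the target
  value is written; a cell that was already correct can only receive that same value again.\<close>

lemma exec_good:
  assumes "good f g (at_counter s0 (reg s (Tmp 0))) c" "same_input s0 s"
  shows "\<exists>s'. exec c s 1 s' \<and> same_input s0 s' \<and> reg s' = reg s \<and>
    insert (cell (at_counter s0 (reg s (Tmp 0))) c) (correct f g s) \<subseteq> correct f g s'"
proof (cases c)
  case (Store a i e)
  let ?s' = "s\<lparr>narr := (narr s)(a := (narr s a)(nval i s := nval e s))\<rparr>"
  have "exec c s 1 ?s'" unfolding Store by (rule exec.Store)
  then show ?thesis
    using assms by (intro exI[of _ ?s'])
      (auto simp: Store same_input_def correct_def nval_input[OF _ assms(2)])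
next
  case (RStore a i e)
  let ?s' = "s\<lparr>rarr := (rarr s)(a := (rarr s a)(nval i s := rval e s))\<rparr>"
  have "exec c s 1 ?s'" unfolding RStore by (rule exec.RStore)
  then show ?thesis
    using assms by (intro exI[of _ ?s'])
      (auto simp: RStore same_input_def correct_def nval_input[OF _ assms(2)] rval_input[OF _ assms(2)])
qed (use assms in auto)

lemma exec_seqs_good:
  assumes "\<forall>c\<in>set cs. good f g (at_counter s0 (reg s (Tmp 0))) c" "same_input s0 s"
  shows "\<exists>s'. exec (seqs cs) s (length cs + 1) s' \<and> same_input s0 s' \<and> reg s' = reg s \<and>
    cell (at_counter s0 (reg s (Tmp 0))) ` set cs \<union> correct f g s \<subseteq> correct f g s'"
  using assms
proof (induction cs arbitrary: s)
  case Nil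
  then show ?case using exec.Skip by auto
next
  case (Cons c cs)
  let ?c = "at_counter s0 (reg s (Tmp 0))"
  obtain s1 where s1: "exec c s 1 s1" "same_input s0 s1" "reg s1 = reg s"
    "insert (cell ?c c) (correct f g s) \<subseteq> correct f g s1"
    using exec_good[of f g s0 s c] Cons.prems by auto
  obtain s2 where s2: "exec (seqs cs) s1 (length cs + 1) s2" "same_input s0 s2" "reg s2 = reg s1"
    "cell ?c ` set cs \<union> correct f g s1 \<subseteq> correct f g s2"
    using Cons.IH[of s1] Cons.prems s1 by auto
  have "exec (seqs (c # cs)) s (length (c # cs) + 1) s2"
    using exec.Seq[OF s1(1) s2(1)] by simp
  moreover have "cell ?c ` set (c # cs) \<union> correct f g s \<subseteq> correct f g s2"
    using s1(4) s2(4) by auto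
  ultimately show ?case using s1 s2 by auto
qed

definition for_loop :: "nat \<Rightarrow> com list \<Rightarrow> com" where
  "for_loop b cs = Seq (Assign (Tmp 0) (Lit 0))
     (While (Less (Reg (Tmp 0)) (Reg (In b))) (Seq (seqs cs) (Assign (Tmp 0) (Add (Reg (Tmp 0)) (Lit 1)))))"

text \<open>An iteration costs \<open>length cs + 3\<close>: the stores, the closing
  \<open>Skip\<close>, the increment and the test. The extra 2 pays for the initial assignment and
  the failing last test.\<close>

lemma exec_for_loop:
  assumes good: "\<And>j c. j < reg s0 (In b) \<Longrightarrow> c \<in> set cs \<Longrightarrow> good f g (at_counter s0 j) c"
    and s: "same_input s0 s"
  shows "\<exists>s'. exec (for_loop b cs) s (reg s0 (In b) * (length cs + 3) + 2) s' \<and> same_input s0 s' \<and>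
    (\<Union>j<reg s0 (In b). cell (at_counter s0 j) ` set cs) \<union> correct f g s \<subseteq> correct f g s'"
proof -
  let ?N = "reg s0 (In b)"
  let ?inc = "Assign (Tmp 0) (Add (Reg (Tmp 0)) (Lit 1))"
  let ?while = "While (Less (Reg (Tmp 0)) (Reg (In b))) (Seq (seqs cs) ?inc)"
  \<comment> \<open>Here \<open>k\<close> is the number of remaining iterations.\<close>
  have loop: "\<exists>s'. exec ?while s (k * (length cs + 3) + 1) s' \<and> same_input s0 s' \<and>
      (\<Union>j\<in>{?N - k..<?N}. cell (at_counter s0 j) ` set cs) \<union> correct f g s \<subseteq> correct f g s'"
    if "same_input s0 s" "reg s (Tmp 0) + k = ?N" for k s
    using that
  proof (induction k arbitrary: s)
    case 0
    then have "exec ?while s 1 s" by (intro exec.WhileFalse) (simp add: same_input_def)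
    then show ?case using 0 by auto
  next
    case (Suc k)
    let ?j = "reg s (Tmp 0)"
    have j: "?j < ?N" "?j = ?N - Suc k" using Suc.prems by auto
    obtain s1 where s1: "exec (seqs cs) s (length cs + 1) s1" "same_input s0 s1" "reg s1 = reg s"
      "cell (at_counter s0 ?j) ` set cs \<union> correct f g s \<subseteq> correct f g s1"
      using exec_seqs_good[of cs f g s0 s] good j Suc.prems by blast
    define s2 where "s2 = s1\<lparr>reg := (reg s1)(Tmp 0 := nval (Add (Reg (Tmp 0)) (Lit 1)) s1)\<rparr>"
    have inc: "exec ?inc s1 1 s2" unfolding s2_def by (rule exec.Assign)
    have s2: "same_input s0 s2" "reg s2 (Tmp 0) = Suc ?j"
      "correct f g s2 = correct f g s1"
      using s1 by (auto simp: s2_def same_input_def correct_def)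
    obtain s3 where s3: "exec ?while s2 (k * (length cs + 3) + 1) s3" "same_input s0 s3"
      "(\<Union>j\<in>{?N - k..<?N}. cell (at_counter s0 j) ` set cs) \<union> correct f g s2 \<subseteq> correct f g s3"
      using Suc.IH[of s2] s2 Suc.prems by auto
    have "bval (Less (Reg (Tmp 0)) (Reg (In b))) s"
      using j Suc.prems by (simp add: same_input_def)
    from exec.WhileTrue[OF this exec.Seq[OF s1(1) inc] s3(1)]
    have "exec ?while s (Suc k * (length cs + 3) + 1) s3"
      by (rule back_subst[where P = "\<lambda>t. exec ?while s t s3"]) (simp add: algebra_simps)
    moreover have "{?N - Suc k..<?N} = insert ?j {?N - k..<?N}" using Suc.prems by auto
    ultimately show ?case using s1 s2 s3 by (intro exI[of _ s3]) auto
  qed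
  define s1 where "s1 = s\<lparr>reg := (reg s)(Tmp 0 := nval (Lit 0) s)\<rparr>"
  have init: "exec (Assign (Tmp 0) (Lit 0)) s 1 s1" unfolding s1_def by (rule exec.Assign)
  have s1: "same_input s0 s1" "reg s1 (Tmp 0) = 0"
    "correct f g s1 = correct f g s"
    using s by (auto simp: s1_def same_input_def correct_def)
  obtain s2 where s2: "exec ?while s1 (?N * (length cs + 3) + 1) s2" "same_input s0 s2"
    "(\<Union>j\<in>{?N - ?N..<?N}. cell (at_counter s0 j) ` set cs) \<union> correct f g s1 \<subseteq> correct f g s2"
    using loop[of s1 ?N] s1 by auto
  have "exec (for_loop b cs) s (?N * (length cs + 3) + 2) s2"
    unfolding for_loop_def using exec.Seq[OF init s2(1)] by simp
  then show ?thesis using s1 s2 by (auto simp: lessThan_atLeast0)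
qed

section \<open>The construction program and its target memory\<close>

abbreviation counter :: nexp where "counter \<equiv> Reg (Tmp 0)"

text \<open>The machine has no multiplication; the factors 2, 6 and 12 come from repeated
  addition.\<close>

definition double :: "nexp \<Rightarrow> nexp" where
  "double e = Add e e"

definition six_times :: "nexp \<Rightarrow> nexp" where
  "six_times e = Add (double e) (double (double e))"

definition code_exp :: "nat \<Rightarrow> nexp \<Rightarrow> nexp" where
  "code_exp c e = Add (double (six_times e)) (Lit c)"

lemma nval_arith [simp]:
  "nval (double e) s = 2 * nval e s" "nval (six_times e) s = 6 * nval e s"
  "nval (code_exp c e) s = code c (nval e s)"
  by (simp_all add: double_def six_times_def code_exp_def code_def)

lemma input_arith [simp]:
  "input_nexp (double e) = input_nexp e" "input_nexp (six_times e) = input_nexp e"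
  "input_nexp (code_exp c e) = input_nexp e"
  by (auto simp: double_def six_times_def code_exp_def)

text \<open>With \<open>n\<close> the common size of the parts of \<open>H\<close>, the first
  \<open>n\<close> positions of each list get the copies of part 3, the next \<open>n\<close> those
  of the mate.\<close>

definition terminal_body :: "com list" where
  "terminal_body = concat (map (\<lambda>i.
     [Store (Out i) counter (code_exp (i - 1) (Read (In 3) counter)),
      Store (Out i) (Add (Reg (In 1)) counter) (code_exp (i - 1) (Read (In (mate i)) counter))])
     [1..<5])"

text \<open>Gadget \<open>j\<close> puts \<open>p\<close> and \<open>q\<close> at positions
  \<open>2 * n + 2 * j\<close> and \<open>2 * n + 2 * j + 1\<close>, and row \<open>r\<close>
  becomes hyperedge \<open>6 * j + r\<close>. The flag is inverted for rows 0 and 1, which are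
  matched when the hyperedge of \<open>H\<close> is not. The tests on \<open>r\<close> and
  \<open>slot\<close> are resolved when the program is built.\<close>

definition gadget_body :: "com list" where
  "gadget_body = concat (map (\<lambda>i.
     [Store (Out i) (Add (double (Reg (In 1))) (double counter)) (code_exp (3 + i) counter),
      Store (Out i) (Add (Add (double (Reg (In 1))) (double counter)) (Lit 1)) (code_exp (7 + i) counter)])
     [1..<5]) @
   concat (map (\<lambda>r.
     Store (Out 0) (Add (six_times counter) (Lit r))
       (if r < 2 then Sub (Lit 1) (Read (In 0) counter) else Read (In 0) counter) #
     RStore (Out 0) (Add (six_times counter) (Lit r)) (if r = 2 then RRead (In 0) counter else RZero) #
     map (\<lambda>i. Store (Out (4 + i)) (Add (six_times counter) (Lit r))
       (code_exp (slot_kind i (slot i r)) (if slot i r < 4 then Read (In (3 + slot i r)) counter else counter)))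
       [1..<5])
     [0..<6])"

definition sizes :: "com list" where
  "sizes = [Assign (Out 0) (six_times (Reg (In 0))),
     Assign (Out 1) (double (Add (Reg (In 1)) (Reg (In 0)))),
     Assign (Out 2) (double (Add (Reg (In 1)) (Reg (In 0)))),
     Assign (Out 3) (double (Add (Reg (In 1)) (Reg (In 0)))),
     Assign (Out 4) (double (Add (Reg (In 1)) (Reg (In 0))))]"

definition construction :: com where
  "construction = Seq (for_loop 1 terminal_body) (Seq (for_loop 0 gadget_body) (seqs sizes))"

definition entry :: "state \<Rightarrow> nat \<Rightarrow> nat \<Rightarrow> nat \<Rightarrow> nat" where
  "entry s i j r = code (slot_kind i (slot i r)) (if slot i r < 4 then narr s (In (3 + slot i r)) j else j)"

text \<open>As \<open>2 * n\<close> is even, the parity of \<open>t\<close> tells \<open>p\<close>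
  from \<open>q\<close>.\<close>

definition target_part :: "state \<Rightarrow> nat \<Rightarrow> nat \<Rightarrow> nat" where
  "target_part s i t = (let n = reg s (In 1) in
     if t < n then code (i - 1) (narr s (In 3) t)
     else if t < 2 * n then code (i - 1) (narr s (In (mate i)) (t - n))
     else code (if even t then 3 + i else 7 + i) ((t - 2 * n) div 2))"

definition target_flag :: "state \<Rightarrow> nat \<Rightarrow> nat" where
  "target_flag s e = (if e mod 6 < 2 then 1 - narr s (In 0) (e div 6) else narr s (In 0) (e div 6))"

definition target :: "state \<Rightarrow> name \<Rightarrow> nat \<Rightarrow> nat" where
  "target s a t = (case a of Out b \<Rightarrow>
      if b = 0 then target_flag s t
      else if b \<le> 4 then target_part s b t
      else entry s (b - 4) (t div 6) (t mod 6)
    | _ \<Rightarrow> 0)"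

definition target_weight :: "state \<Rightarrow> nat \<Rightarrow> real" where
  "target_weight s e = (if e mod 6 = 2 then rarr s (In 0) (e div 6) else 0)"

lemma good_terminal_body:
  "j < reg s (In 1) \<Longrightarrow> c \<in> set terminal_body \<Longrightarrow> good (target s) (target_weight s) (at_counter s j) c"
  unfolding terminal_body_def by (auto simp: target_def target_part_def simp del: upt_rec_numeral)

lemma good_gadget_body:
  assumes "c \<in> set gadget_body"
  shows "good (target s) (target_weight s) (at_counter s j) c"
proof -
  have "Suc (Suc (6 * j)) div 6 = j" by presburger
  then show ?thesis
    using assms unfolding gadget_body_def
    by (auto simp: target_def target_part_def target_flag_def target_weight_def entry_def
      simp del: upt_rec_numeral)
qed

text \<open>The first is 4 times 2. The second is 4 times 2 plus 6 rows of 6 stores: flag, weight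
  and four coordinates.\<close>

lemma length_bodies: "length terminal_body = 8" "length gadget_body = 44"
  unfolding terminal_body_def gadget_body_def
  by (simp_all add: length_concat comp_def sum_list_triv)

lemma exec_sizes:
  "\<exists>s'. exec (seqs sizes) s 6 s' \<and> narr s' = narr s \<and> rarr s' = rarr s \<and>
    reg s' (Out 0) = 6 * reg s (In 0) \<and>
    (\<forall>i\<in>{1..4}. reg s' (Out i) = 2 * (reg s (In 1) + reg s (In 0)))"
proof -
  \<comment> \<open>The time is written as a nested sum to match the shape produced by
    \<open>exec.Seq\<close>.\<close>
  have "\<exists>s'. exec (seqs sizes) s (1 + (1 + (1 + (1 + (1 + 1))))) s' \<and> narr s' = narr s \<and> rarr s' = rarr s \<and>
    reg s' (Out 0) = 6 * reg s (In 0) \<and>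
    (\<forall>i\<in>{1..4}. reg s' (Out i) = 2 * (reg s (In 1) + reg s (In 0)))"
    unfolding sizes_def seqs.simps small_intervals
    by (rule exI, rule conjI, (rule exec.Seq exec.Assign exec.Skip)+) simp
  moreover have "1 + (1 + (1 + (1 + (1 + 1)))) = (6::nat)" by simp
  ultimately show ?thesis by (simp only:)
qed

text \<open>The loop bodies have 8 and 44 stores, giving \<open>n * 11 + 2\<close> and
  \<open>m * 47 + 2\<close> steps; the size assignments take 6.\<close>

lemma exec_construction:
  assumes "n = reg s (In 1)" "m = reg s (In 0)"
  shows "\<exists>s'. exec construction s (11 * n + 47 * m + 10) s' \<and>
    reg s' (Out 0) = 6 * m \<and> (\<forall>i\<in>{1..4}. reg s' (Out i) = 2 * (n + m)) \<and>
    (\<forall>i\<in>{1..4}. \<forall>t<2 * (n + m). narr s' (Out i) t = target_part s i t) \<and>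
    (\<forall>e<6 * m. (\<forall>i\<in>{1..4}. narr s' (Out (4 + i)) e = entry s i (e div 6) (e mod 6)) \<and>
      narr s' (Out 0) e = target_flag s e \<and> rarr s' (Out 0) e = target_weight s e)"
proof -
  let ?C = "correct (target s) (target_weight s)"
  have "same_input s s" by (simp add: same_input_def)
  then obtain s1 where s1: "exec (for_loop 1 terminal_body) s (n * 11 + 2) s1" "same_input s s1"
    "(\<Union>j<n. cell (at_counter s j) ` set terminal_body) \<subseteq> ?C s1"
    using exec_for_loop[of s 1 terminal_body "target s" "target_weight s" s] good_terminal_body assms
    by (auto simp: length_bodies)
  obtain s2 where s2: "exec (for_loop 0 gadget_body) s1 (m * 47 + 2) s2" "same_input s s2"
    "(\<Union>j<m. cell (at_counter s j) ` set gadget_body) \<union> ?C s1 \<subseteq> ?C s2"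
    using exec_for_loop[of s 0 gadget_body "target s" "target_weight s" s1] good_gadget_body assms s1(2)
    by (auto simp: length_bodies)
  obtain s3 where s3: "exec (seqs sizes) s2 6 s3" "narr s3 = narr s2" "rarr s3 = rarr s2"
    "reg s3 (Out 0) = 6 * m" "\<forall>i\<in>{1..4}. reg s3 (Out i) = 2 * (n + m)"
    using exec_sizes[of s2] s2(2) assms by (auto simp: same_input_def)
  have "exec construction s (11 * n + 47 * m + 10) s3"
    unfolding construction_def
    using exec.Seq[OF s1(1) exec.Seq[OF s2(1) s3(1)]] by (simp add: algebra_simps)
  moreover have narr_ok: "narr s3 (Out a) t = target s (Out a) t" if "Inl (Out a, t) \<in> ?C s2" for a t
    using that s3 by (auto simp: correct_def)
  have t1: "cell (at_counter s j) c \<in> ?C s2" if "j < n" "c \<in> set terminal_body" for j c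
    using s1(3) s2(3) that by blast
  have t2: "cell (at_counter s j) c \<in> ?C s2" if "j < m" "c \<in> set gadget_body" for j c
    using s2(3) that by blast
  have "narr s3 (Out i) t = target_part s i t" if i: "i \<in> {1..4}" and t: "t < 2 * (n + m)" for i t
  proof -
    have "Inl (Out i, t) \<in> ?C s2"
    proof -
      \<comment> \<open>Every position is hit by some store: two blocks of copies, then
        \<open>p\<close> and \<open>q\<close> alternating.\<close>
      consider "t < n" | "n \<le> t" "t < 2 * n" | j where "t = 2 * n + 2 * j" "j < m"
        | j where "t = 2 * n + 2 * j + 1" "j < m"
      proof -
        have "\<exists>j<m. t = 2 * n + 2 * j \<or> t = 2 * n + 2 * j + 1" if "2 * n \<le> t"
          using that t by (intro exI[of _ "(t - 2 * n) div 2"]) presburger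
        then show ?thesis using that by force
      qed
      then show ?thesis
      proof cases
        case 1
        have "Store (Out i) counter (code_exp (i - 1) (Read (In 3) counter)) \<in> set terminal_body"
          using i by (force simp: terminal_body_def simp del: upt_rec_numeral)
        from t1[OF 1 this] show ?thesis by simp
      next
        case 2
        have "Store (Out i) (Add (Reg (In 1)) counter) (code_exp (i - 1) (Read (In (mate i)) counter))
            \<in> set terminal_body"
          using i by (force simp: terminal_body_def simp del: upt_rec_numeral)
        from t1[OF _ this, of "t - n"] 2 show ?thesis by (simp add: assms)
      next
        case (3 j)
        have "Store (Out i) (Add (double (Reg (In 1))) (double counter)) (code_exp (3 + i) counter)
            \<in> set gadget_body"
          using i by (force simp: gadget_body_def simp del: upt_rec_numeral)
        from t2[OF 3(2) this] 3 show ?thesis by (simp add: assms)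
      next
        case (4 j)
        have "Store (Out i) (Add (Add (double (Reg (In 1))) (double counter)) (Lit 1)) (code_exp (7 + i) counter)
            \<in> set gadget_body"
          using i by (force simp: gadget_body_def simp del: upt_rec_numeral)
        from t2[OF 4(2) this] 4 show ?thesis by (simp add: assms)
      qed
    qed
    from narr_ok[OF this] show ?thesis using i by (auto simp: target_def)
  qed
  moreover have "(\<forall>i\<in>{1..4}. narr s3 (Out (4 + i)) e = entry s i (e div 6) (e mod 6)) \<and>
      narr s3 (Out 0) e = target_flag s e \<and> rarr s3 (Out 0) e = target_weight s e" if "e < 6 * m" for e
  proof -
    define j r where "j = e div 6" and "r = e mod 6"
    have e: "e = 6 * j + r" "j < m" "r < 6" using that by (auto simp: j_def r_def)
    have "Store (Out 0) (Add (six_times counter) (Lit r))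
       (if r < 2 then Sub (Lit 1) (Read (In 0) counter) else Read (In 0) counter) \<in> set gadget_body"
      using e(3) by (force simp: gadget_body_def simp del: upt_rec_numeral)
    from t2[OF e(2) this] have 1: "Inl (Out 0, e) \<in> ?C s2" by (simp add: e)
    have "RStore (Out 0) (Add (six_times counter) (Lit r)) (if r = 2 then RRead (In 0) counter else RZero)
        \<in> set gadget_body"
      using e(3) by (force simp: gadget_body_def simp del: upt_rec_numeral)
    from t2[OF e(2) this] have 2: "Inr e \<in> ?C s2" by (simp add: e)
    have 3: "Inl (Out (4 + i), e) \<in> ?C s2" if "i \<in> {1..4}" for i
    proof -
      have "Store (Out (4 + i)) (Add (six_times counter) (Lit r))
         (code_exp (slot_kind i (slot i r)) (if slot i r < 4 then Read (In (3 + slot i r)) counter else counter))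
         \<in> set gadget_body"
        using e(3) that by (force simp: gadget_body_def simp del: upt_rec_numeral)
      from t2[OF e(2) this] show ?thesis by (simp add: e)
    qed
    show ?thesis
      using narr_ok[OF 1] 2 narr_ok[OF 3] s3(3) by (auto simp: target_def correct_def)
  qed
  ultimately show ?thesis using s3 by blast
qed

section \<open>Correctness of the construction\<close>

context gadgets
begin

lemma coord_eq_entry:
  assumes "i \<in> {1..4}" "e \<in> rows" "\<And>t. t \<in> {1..3} \<Longrightarrow> narr s (In (3 + t)) = X t"
  shows "coord i e = entry s i (fst e) (snd e)"
proof -
  have "slot i (snd e) \<in> {1..5}" using assms slot_in unfolding rows_def by auto
  then show ?thesis using assms(3) unfolding coord_def entry_def Let_def by simp
qed

text \<open>The list exhausts the part and has exactly as many positions as the part has elements,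
  so it is also injective.\<close>

lemma bij_betw_target_part:
  assumes i: "i \<in> {1..4}" and n: "reg s (In 1) = n"
    and lists: "\<And>t. t \<in> {1..3} \<Longrightarrow> bij_betw (narr s (In t)) {..<n} (W t)"
  shows "bij_betw (target_part s i) {..<2 * (n + m)} (part i)"
proof -
  have mate: "mate i \<in> {1..3}" using mate_in[of i] by auto
  have W: "W 3 = narr s (In 3) ` {..<n}" "W (mate i) = narr s (In (mate i)) ` {..<n}"
    using lists[of 3] lists[OF mate] by (auto simp: bij_betw_def)
  have card_W: "card (W 3) = n" "card (W (mate i)) = n"
    using bij_betw_same_card[OF lists[of 3]] bij_betw_same_card[OF lists[OF mate]] by auto
  let ?f = "target_part s i"
  have low: "?f t = code (i - 1) (narr s (In 3) t)" "?f (n + t) = code (i - 1) (narr s (In (mate i)) t)"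
    if "t < n" for t
    using that n by (auto simp: target_part_def)
  have high: "?f (2 * n + 2 * j) = code (3 + i) j" "?f (2 * n + 2 * j + 1) = code (7 + i) j" for j
    using n by (auto simp: target_part_def)
  have "part i \<subseteq> ?f ` {..<2 * (n + m)}"
  proof
    fix v assume "v \<in> part i"
    then consider t where "t < n" "v = ?f t" | t where "t < n" "v = ?f (n + t)"
      | j where "j < m" "v = ?f (2 * n + 2 * j)" | j where "j < m" "v = ?f (2 * n + 2 * j + 1)"
      unfolding part_def W using low high by force
    then show "v \<in> ?f ` {..<2 * (n + m)}"
      by cases (auto intro!: imageI)
  qed
  moreover have "card (part i) = 2 * (n + m)" using card_part[OF i] card_W by simp
  ultimately have "?f ` {..<2 * (n + m)} = part i"
    by (metis card_image_le card_lessThan card_seteq finite_imageI finite_lessThan)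
  moreover have "inj_on ?f {..<2 * (n + m)}"
    using \<open>card (part i) = _\<close> calculation by (intro eq_card_imp_inj_on) auto
  ultimately show ?thesis by (simp add: bij_betw_def)
qed

definition row_of :: "nat \<Rightarrow> nat \<times> nat" where
  "row_of e = (e div 6, e mod 6)"

lemma bij_betw_row_of: "bij_betw row_of {..<6 * m} rows"
proof (rule bij_betwI)
  show "row_of \<in> {..<6 * m} \<rightarrow> rows" by (auto simp: row_of_def rows_def)
  show "(\<lambda>e. 6 * fst e + snd e) \<in> rows \<rightarrow> {..<6 * m}" by (auto simp: rows_def)
qed (auto simp: row_of_def rows_def)

end

lemma construction_correct:
  fixes V :: "'a set"
  assumes hyper: "k_hypergraph 3 V E" and partite: "k_partite 3 U V E"
    and linear: "almost_disjoint E" and pm: "perfect_matching V E P"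
    and zero: "\<forall>e\<in>P. w e = 0" and inj: "inj_on \<nu> V" and enc: "encodes In 3 \<nu> U E P w s"
  shows "\<exists>(t::nat) s'. exec construction s t s' \<and> t \<le> poly [:10, 47:] (card V + card E) \<and>
    (\<exists>(V'::nat set) (U'::nat \<Rightarrow> nat set) (E'::nat set set) (P'::nat set set) (w'::nat set \<Rightarrow> real).
      encodes Out 4 (\<lambda>v. v) U' E' P' w' s' \<and>
      k_hypergraph 4 V' E' \<and> k_partite 4 U' V' E' \<and> almost_disjoint E' \<and>
      perfect_matching V' E' P' \<and> (\<forall>e\<in>P'. w' e = 0) \<and>
      (\<exists>T'. is_signing 4 U' (transition_matrix 4 E' w') T' \<and>
        hyper_per 3 U (transition_matrix 3 E w) = hyper_det 4 U' T'))"
proof -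
  define m where "m = card E"
  define n where "n = card (U 1)"
  define W where "W i = \<nu> ` U i" for i
  define X where "X i = narr s (In (3 + i))" for i
  have V: "finite V" "V = (\<Union>i\<in>{1..3}. U i)" and disj: "disjoint_family_on U {1..3}"
    using hyper partite unfolding k_hypergraph_def k_partite_def by auto
  have U_sub: "U i \<subseteq> V" if "i \<in> {1..3}" for i using that V by blast
  obtain es where es: "bij_betw es {..<m} E"
    and es_X: "\<And>j i. j < m \<Longrightarrow> i \<in> {1..3} \<Longrightarrow> X i j \<in> \<nu> ` (es j \<inter> U i)"
    and flag: "\<And>j. j < m \<Longrightarrow> narr s (In 0) j = (if es j \<in> P then 1 else 0)"
    and weight: "\<And>j. j < m \<Longrightarrow> rarr s (In 0) j = w (es j)"
    using enc unfolding encodes_def m_def X_def by blast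
  have es_E: "es j \<in> E" if "j < m" for j using es that by (auto simp: bij_betw_def)
  have es_inj: "j = j'" if "j < m" "j' < m" "es j = es j'" for j j'
    using es that by (auto simp: bij_betw_def inj_on_def)
  \<comment> \<open>The vertex of hyperedge \<open>j\<close> in part \<open>i\<close>, unique by
    partiteness; \<open>X\<close> holds its number under \<nu>.\<close>
  define x where "x i j = the_elem (es j \<inter> U i)" for i j
  have es_Int: "es j \<inter> U i = {x i j}" if "j < m" "i \<in> {1..3}" for i j
  proof -
    have "card (es j \<inter> U i) = 1" using partite es_E that unfolding k_partite_def by blast
    then show ?thesis unfolding x_def by (metis card_1_singletonE the_elem_eq)
  qed
  have es_eq: "es j = (\<lambda>i. x i j) ` {1..3}" if "j < m" for j
  proof -
    have "es j \<subseteq> V" using hyper es_E[OF that] unfolding k_hypergraph_def by blast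
    then have "es j = (\<Union>i\<in>{1..3}. es j \<inter> U i)" using V by blast
    also have "\<dots> = (\<Union>i\<in>{1..3}. {x i j})" using es_Int[OF that] by (intro SUP_cong) auto
    finally show ?thesis by blast
  qed
  have X_x: "X i j = \<nu> (x i j)" if "j < m" "i \<in> {1..3}" for i j
    using es_X[OF that] es_Int[OF that] by auto
  have x_in: "x i j \<in> U i" if "j < m" "i \<in> {1..3}" for i j
    using es_Int[OF that] by blast
  have nu_eq: "u = v" if "\<nu> u = \<nu> v" "u \<in> U i" "v \<in> U i'" "i \<in> {1..3}" "i' \<in> {1..3}" for u v i i'
    using inj that U_sub unfolding inj_on_def by blast

  interpret H: indexed_hypergraph 3 U "{..<m}" x
  proof
    show "finite (U i)" if "i \<in> {1..3}" for i by (rule finite_subset[OF U_sub[OF that] V(1)])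
    fix j j' assume j: "j \<in> {..<m}" "j' \<in> {..<m}" "\<And>i. i \<in> {1..3} \<Longrightarrow> x i j = x i j'"
    then have "es j = es j'" using es_eq by simp
    then show "j = j'" using es_inj j by blast
  qed (use disj x_in in auto)
  have H_edge: "H.edge j = es j" if "j < m" for j
    unfolding H.edge_def using es_eq[OF that] by simp
  have E: "E = H.edge ` {..<m}" using es H_edge by (auto simp: bij_betw_def)

  interpret G: gadgets m W X
  proof
    show "disjoint_family_on W {1..3}"
      unfolding disjoint_family_on_def
    proof (intro ballI impI)
      fix i i' :: nat assume *: "i \<in> {1..3}" "i' \<in> {1..3}" "i \<noteq> i'"
      show "W i \<inter> W i' = {}"
      proof (rule ccontr)
        assume "W i \<inter> W i' \<noteq> {}"
        then obtain u v where "u \<in> U i" "v \<in> U i'" "\<nu> u = \<nu> v" unfolding W_def by blast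
        then show False using nu_eq * H.part_unique by metis
      qed
    qed
    fix j j' assume j: "j \<in> {..<m}" "j' \<in> {..<m}" "\<And>i. i \<in> {1..3} \<Longrightarrow> X i j = X i j'"
    have "x i j = x i j'" if "i \<in> {1..3}" for i
      using nu_eq[of "x i j" "x i j'" i i] X_x x_in j that by auto
    then show "j = j'" using H.coord_inj j by blast
  next
    fix j j' t t'
    assume *: "j < m" "j' < m" "t \<in> {1..3}" "t' \<in> {1..3}" "t \<noteq> t'" "X t j = X t j'" "X t' j = X t' j'"
    have eq: "x t j = x t j'" "x t' j = x t' j'"
      using nu_eq[of "x t j" "x t j'" t t] nu_eq[of "x t' j" "x t' j'" t' t'] * X_x x_in by auto
    have ne: "x t j \<noteq> x t' j" using H.part_unique[of "x t j" t t'] x_in * by metis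
    \<comment> \<open>Agreement in two parts gives two distinct common vertices, so almost
      disjointness forces equal hyperedges.\<close>
    have "{x t j, x t' j} \<subseteq> es j \<inter> es j'"
      using es_Int[of j t] es_Int[of j t'] es_Int[of j' t] es_Int[of j' t'] eq * by blast
    moreover have "finite (es j)" using es_eq *(1) by simp
    ultimately have "card {x t j, x t' j} \<le> card (es j \<inter> es j')" by (intro card_mono) auto
    then have "\<not> card (es j \<inter> es j') \<le> 1" using ne by simp
    then have "es j = es j'" using linear es_E * unfolding almost_disjoint_def by blast
    then show "j = j'" using es_inj * by blast
  qed (use H.finite_part x_in X_x in \<open>auto simp: W_def\<close>)

  \<comment> \<open>Renaming by \<nu> is injective on each part and preserves bijectivity of the
    coordinates.\<close>
  have matching_iff: "H.matching J \<longleftrightarrow> G.matching J" for J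
  proof -
    have "bij_betw (x i) J (U i) \<longleftrightarrow> bij_betw (X i) J (W i)" if "J \<subseteq> {..<m}" "i \<in> {1..3}" for i
    proof -
      have "bij_betw \<nu> (U i) (W i)"
        using inj U_sub[OF that(2)] unfolding W_def by (auto simp: bij_betw_def intro: inj_on_subset)
      moreover have "x i ` J \<subseteq> U i" using x_in that by auto
      ultimately have "bij_betw (x i) J (U i) \<longleftrightarrow> bij_betw (\<nu> \<circ> x i) J (W i)"
        by (rule bij_betw_comp_iff2)
      also have "\<dots> \<longleftrightarrow> bij_betw (X i) J (W i)"
        using X_x that by (intro bij_betw_cong) auto
      finally show ?thesis .
    qed
    then show ?thesis unfolding H.matching_def G.matching_def by blast
  qed

  define J where "J = {j. j < m \<and> es j \<in> P}"
  have J_sub: "J \<subseteq> {..<m}" by (auto simp: J_def)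
  have "P \<subseteq> E" using pm unfolding perfect_matching_def by blast
  then have "P = H.edge ` J" using E H_edge unfolding J_def by auto
  then have HJ: "H.matching J" using pm H.perfect_matching_edge_iff[OF J_sub] V(2) E by simp
  \<comment> \<open>The given perfect matching is in bijection with every part; this justifies using
    the register of part 1 as the common size.\<close>
  have card_U: "card (U i) = n" if "i \<in> {1..3}" for i
    using HJ that unfolding H.matching_def n_def by (metis atLeastAtMost_iff bij_betw_same_card le_numeral_extra(4) one_le_numeral)
  have lists: "bij_betw (narr s (In i)) {..<n} (W i)" if "i \<in> {1..3}" for i
    using enc that card_U unfolding encodes_def W_def by metis
  have reg_n: "reg s (In 1) = n" and reg_m: "reg s (In 0) = m"
    using enc unfolding encodes_def n_def m_def by auto

  obtain s' where s': "exec construction s (11 * n + 47 * m + 10) s'"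
    and out0: "reg s' (Out 0) = 6 * m" and outi: "\<And>i. i \<in> {1..4} \<Longrightarrow> reg s' (Out i) = 2 * (n + m)"
    and out_part: "\<And>i t. i \<in> {1..4} \<Longrightarrow> t < 2 * (n + m) \<Longrightarrow> narr s' (Out i) t = target_part s i t"
    and out_edge: "\<And>i e. e < 6 * m \<Longrightarrow> i \<in> {1..4} \<Longrightarrow> narr s' (Out (4 + i)) e = entry s i (e div 6) (e mod 6)"
    and out_flag: "\<And>e. e < 6 * m \<Longrightarrow> narr s' (Out 0) e = target_flag s e"
    and out_weight: "\<And>e. e < 6 * m \<Longrightarrow> rarr s' (Out 0) e = target_weight s e"
    using exec_construction[OF reg_n[symmetric] reg_m[symmetric]] by blast

  \<comment> \<open>Weights are functions of vertex sets, so the index is recovered by inverting the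
    injective \<open>G.new.edge\<close>.\<close>
  define w' where "w' S = (let e = inv_into G.rows G.new.edge S in
    if snd e = 2 then rarr s (In 0) (fst e) else 0)" for S
  have w': "w' (G.new.edge e) = (if snd e = 2 then rarr s (In 0) (fst e) else 0)" if "e \<in> G.rows" for e
    unfolding w'_def using that by (simp add: inv_into_f_f[OF G.new.inj_on_edge])
  let ?E = "G.new.edge ` G.rows" and ?P = "G.new.edge ` G.covering J"
  have cov: "G.covering J \<subseteq> G.rows" by (auto simp: G.covering_def)

  have "hyper_per 3 U (transition_matrix 3 E w) =
      (\<Sum>J | H.matching J. \<Prod>j\<in>J. Poly_Mapping.single (w (H.edge j)) 1)"
    unfolding E by (rule H.hyper_per_transition_matrix)
  also have "\<dots> = (\<Sum>J | G.matching J. \<Prod>j\<in>J. Poly_Mapping.single (rarr s (In 0) j) 1)"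
    unfolding matching_iff using weight H_edge
    by (intro sum.cong prod.cong) (auto simp: G.matching_def)
  also have "\<dots> = hyper_det 4 G.part (transition_matrix 4 ?E w')"
    by (rule G.hyper_det_new_eq_sum[symmetric]) (rule w')
  finally have per: "hyper_per 3 U (transition_matrix 3 E w) = \<dots>" .

  have "encodes Out 4 (\<lambda>v. v) G.part ?E ?P w' s'"
  proof -
    have parts: "bij_betw (narr s' (Out i)) {..<2 * (n + m)} (G.part i)" if "i \<in> {1..4}" for i
      using G.bij_betw_target_part[OF that reg_n lists] out_part[OF that]
      by (subst bij_betw_cong[where g = "target_part s i"]) auto
    then have card_parts: "card (G.part i) = 2 * (n + m)" if "i \<in> {1..4}" for i
      using bij_betw_same_card[OF parts[OF that]] by simp
    have "bij_betw G.new.edge G.rows ?E" using G.new.inj_on_edge by (simp add: bij_betw_def)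
    then have edges: "bij_betw (G.new.edge \<circ> G.row_of) {..<6 * m} ?E"
      using bij_betw_trans[OF G.bij_betw_row_of] by blast
    then have card_E: "card ?E = 6 * m" using bij_betw_same_card by force
    have row: "G.row_of e \<in> G.rows" if "e < 6 * m" for e
      using G.bij_betw_row_of that by (auto simp: bij_betw_def)
    have coords: "narr s' (Out (4 + i)) e \<in> (\<lambda>v. v) ` ((G.new.edge \<circ> G.row_of) e \<inter> G.part i)"
      if "e < 6 * m" "i \<in> {1..4}" for e i
      using G.new.edge_Int_part[OF row[OF that(1)] that(2)] out_edge[OF that]
        G.coord_eq_entry[OF that(2) row[OF that(1)], of s]
      by (simp add: X_def G.row_of_def)
    have flags: "narr s' (Out 0) e = (if (G.new.edge \<circ> G.row_of) e \<in> ?P then 1 else 0)" if "e < 6 * m" for e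
    proof -
      have "e div 6 < m" using that by auto
      then have "narr s' (Out 0) e = (if G.row_of e \<in> G.covering J then 1 else 0)"
        using out_flag[OF that] flag row[OF that]
        by (auto simp: target_flag_def G.row_of_def G.covering_def J_def)
      also have "G.row_of e \<in> G.covering J \<longleftrightarrow> G.new.edge (G.row_of e) \<in> ?P"
        using inj_on_image_mem_iff[OF G.new.inj_on_edge row[OF that] cov] by simp
      finally show ?thesis by simp
    qed
    have weights: "rarr s' (Out 0) e = w' ((G.new.edge \<circ> G.row_of) e)" if "e < 6 * m" for e
      using out_weight[OF that] w'[OF row[OF that]] by (simp add: target_weight_def G.row_of_def)
    show ?thesis
      unfolding encodes_def card_E
    proof (intro conjI ballI exI[of _ "G.new.edge \<circ> G.row_of"])
      fix i :: nat assume i: "i \<in> {1..4}"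
      show "reg s' (Out i) = card (G.part i)" using outi[OF i] card_parts[OF i] by simp
      show "bij_betw (narr s' (Out i)) {..<card (G.part i)} ((\<lambda>v. v) ` G.part i)"
        using parts[OF i] card_parts[OF i] by simp
    qed (use out0 edges coords flags weights in blast)+
  qed
  moreover have "k_hypergraph 4 (\<Union>i\<in>{1..4}. G.part i) ?E" by (rule G.new.k_hypergraph_edge)
  moreover have "k_partite 4 G.part (\<Union>i\<in>{1..4}. G.part i) ?E" by (rule G.new.k_partite_edge)
  moreover have "almost_disjoint ?E" by (rule G.almost_disjoint_new)
  moreover have "perfect_matching (\<Union>i\<in>{1..4}. G.part i) ?E ?P"
    using G.new.perfect_matching_edge_iff[OF cov] G.matching_covering_iff[OF J_sub] HJ matching_iff by simp
  moreover have "\<forall>e\<in>?P. w' e = 0"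
  proof
    fix S assume "S \<in> ?P"
    then obtain e where e: "e \<in> G.covering J" "S = G.new.edge e" by blast
    then show "w' S = 0"
      using w'[of e] cov weight[of "fst e"] zero by (auto simp: G.covering_def J_def)
  qed
  \<comment> \<open>Here \<open>n\<close> is at most \<open>card V\<close>, as part 1 is a subset of
    \<open>V\<close>, and 11 is at most 47.\<close>
  moreover have "11 * n + 47 * m + 10 \<le> poly [:10, 47:] (card V + card E)"
    using card_mono[OF V(1) U_sub[of 1]] by (simp add: n_def m_def)
  \<comment> \<open>The transition matrix serves as its own signing.\<close>
  moreover have "is_signing 4 G.part (transition_matrix 4 ?E w') (transition_matrix 4 ?E w')"
    by (simp add: is_signing_def)
  ultimately show ?thesis using s' per by (intro exI conjI)
qed

theorem theorem2p10:
  shows "\<exists>(c::com) (p::nat poly).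
    \<forall>(V::'a set) (U::nat \<Rightarrow> 'a set) (E::'a set set) (P::'a set set) (w::'a set \<Rightarrow> real)
      (\<nu>::'a \<Rightarrow> nat) (s::state).
      k_hypergraph 3 V E \<and> k_partite 3 U V E \<and> almost_disjoint E \<and>
      perfect_matching V E P \<and> (\<forall>e\<in>P. w e = 0) \<and>
      inj_on \<nu> V \<and> encodes In 3 \<nu> U E P w s \<longrightarrow>
      (\<exists>(t::nat) (s'::state).
        exec c s t s' \<and> t \<le> poly p (card V + card E) \<and>
        (\<exists>(V'::nat set) (U'::nat \<Rightarrow> nat set) (E'::nat set set) (P'::nat set set)
          (w'::nat set \<Rightarrow> real).
          encodes Out 4 (\<lambda>v. v) U' E' P' w' s' \<and>
          k_hypergraph 4 V' E' \<and> k_partite 4 U' V' E' \<and> almost_disjoint E' \<and>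
          perfect_matching V' E' P' \<and> (\<forall>e\<in>P'. w' e = 0) \<and>
          (\<exists>T'. is_signing 4 U' (transition_matrix 4 E' w') T' \<and>
            hyper_per 3 U (transition_matrix 3 E w) = hyper_det 4 U' T')))"
  by (intro exI[of _ construction] exI[of _ "[:10, 47:]"] allI impI) (elim conjE, rule construction_correct)

end
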